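(* Let $I$ be a finite poset and let $\mathcal J=(I,\le,G_i,\varphi_{ji}\,(i<j))$ be an $I$-system. Then $M(\mathcal J)$ is a conical refinement monoid.
   Context: All monoids and semigroups are commutative, written additively; $\mathbb N=\{1,2,\dots\}$. A monoid $M$ is conical if $x+y=0$ implies $x=y=0$. $M$ is a refinement monoid if whenever $a+b=c+d$ there are $w,x,y,z\in M$ with $a=w+x$, $b=y+z$, $c=w+y$, $d=x+z$. $I$-systems. Let $(I,\le)$ be a poset. An $I$-system $\mathcal J=(I,\le,(G_i)_{i\in I},\varphi_{ji}\,(i<j))$ consists of: (a) a partition $I=I_{\rm free}\sqcup I_{\rm reg}$ (one part may be empty); (b) abelian groups $G_i$, $i\in I$ (arbitrary, not necessarily finitely generated); put $M_i=\widehat G_i=G_i$ if $i\in I_{\rm reg}$, and $M_i=\mathbb N\times G_i$, $\widehat G_i=\mathbb Z\times G_i$ if $i\in I_{\rm free}$; $G_i$ is viewed as the subgroup $\{0\}\times G_i$ of $\widehat G_i$ when $i$ is free; (c) semigroup homomorphisms $\varphi_{ji}\colon M_i\to G_j$ for $i<j$, with unique extensions to group homomorphisms $\widehat\varphi_{ji}\colon\widehat G_i\to G_j\subseteq\widehat G_j$, such that: (c1) $i\mapsto\widehat G_i$, $(i<j)\mapsto\widehat\varphi_{ji}$, with $\widehat\varphi_{ii}=\mathrm{id}$, is a functor from $I$ to abelian groups; (c2) for each $i\in I_{\rm free}$, every element of $G_i$ is a finite sum of elements $\varphi_{ik}(x)$ with $k<i$, $x\in M_k$ (for $i$ minimal this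 means that $G_i$ is trivial). The monoid $M(\mathcal J)$. Let $A(I)$ be the set of lower subsets $a$ of $I$ such that the set $\mathrm{Max}(a)$ of maximal elements of $a$ is finite and every element of $a$ lies below some element of $\mathrm{Max}(a)$ (including $a=\emptyset$). For $a\in A(I)$ let $\widehat H_a=\bigoplus_{i\in a}\widehat G_i$; for $i\in a$, $u\in\widehat G_i$ let $\chi(a,i,u)\in\widehat H_a$ have $i$-th component $u$ and all other components $0$; let $U_a$ be the subgroup generated by all $\chi(a,i,u)-\chi(a,j,\widehat\varphi_{ji}(u))$ with $i<j$, $j\in\mathrm{Max}(a)$, $u\in\widehat G_i$. Let $H_a$ be the subsemigroup of all $(z_i)_{i\in a}\in\widehat H_a$ with $z_i\in\mathbb N\times G_i$ for each free $i\in\mathrm{Max}(a)$ and $z_i\in\{(0,0_i)\}\cup(\mathbb N\times G_i)$ for each free $i\in a\setminus\mathrm{Max}(a)$ (no condition for regular $i$). Put $M_a=H_a/{\sim}$, where $x\sim y$ iff $x-y\in U_a$. With $f_a^b\colon\widehat H_a\to\widehat H_b$ the canonical embedding for $a\subseteq b$, $M(\mathcal J)=\bigsqcup_{a\in A(I)}M_a$ with $[x]+[y]=[f_a^{a\cup b}(x)+f_b^{a\cup b}(y)]\in M_{a\cup b}$. *)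

theory Defs
  imports "HOL-Algebra.FiniteProduct" "HOL-Algebra.Product_Groups"
begin

text \<open>
  Commutative monoids and abelian groups are the multiplicatively written \<open>comm_monoid\<close> and
  \<open>comm_group\<close> of \<open>HOL-Algebra\<close>; the additive notation \<open>x + y\<close>, \<open>0\<close>, \<open>- x\<close> of the mathematics
  reads \<open>x \<otimes> y\<close>, \<open>\<one>\<close>, \<open>inv x\<close> here.
\<close>

definition conical_monoid :: "('a, 'b) monoid_scheme \<Rightarrow> bool" where
  "conical_monoid M \<longleftrightarrow> comm_monoid M \<and>
     (\<forall>x\<in>carrier M. \<forall>y\<in>carrier M. x \<otimes>\<^bsub>M\<^esub> y = \<one>\<^bsub>M\<^esub> \<longrightarrow> x = \<one>\<^bsub>M\<^esub> \<and> y = \<one>\<^bsub>M\<^esub>)"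

definition refinement_monoid :: "('a, 'b) monoid_scheme \<Rightarrow> bool" where
  "refinement_monoid M \<longleftrightarrow> comm_monoid M \<and>
     (\<forall>a\<in>carrier M. \<forall>b\<in>carrier M. \<forall>c\<in>carrier M. \<forall>d\<in>carrier M.
        a \<otimes>\<^bsub>M\<^esub> b = c \<otimes>\<^bsub>M\<^esub> d \<longrightarrow>
        (\<exists>w\<in>carrier M. \<exists>x\<in>carrier M. \<exists>y\<in>carrier M. \<exists>z\<in>carrier M.
           a = w \<otimes>\<^bsub>M\<^esub> x \<and> b = y \<otimes>\<^bsub>M\<^esub> z \<and> c = w \<otimes>\<^bsub>M\<^esub> y \<and> d = x \<otimes>\<^bsub>M\<^esub> z))"

section \<open>\<open>I\<close>-systems\<close>

text \<open>
  \<open>Phi J j i\<close> is \<open>\<phi>\<^bsub>ji\<^esub>\<close>; its values matter only for \<open>i < j\<close> and arguments in \<open>M\<^sub>i\<close>.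
  All the groups \<open>G\<^sub>i\<close> have their carriers in one type \<open>'g\<close>, which is no restriction since any
  family of groups can be copied into a disjoint sum.
\<close>

record ('i, 'g) sys =
  Idx :: "'i set"
  Le :: "('i \<times> 'i) set"
  Free :: "'i set"
  Reg :: "'i set"
  Grp :: "'i \<Rightarrow> 'g monoid"
  Phi :: "'i \<Rightarrow> 'i \<Rightarrow> int \<times> 'g \<Rightarrow> 'g"

definition lt :: "('i, 'g) sys \<Rightarrow> 'i \<Rightarrow> 'i \<Rightarrow> bool" where
  "lt J i j \<longleftrightarrow> (i, j) \<in> Le J \<and> i \<noteq> j"

text \<open>
  To give all \<open>hat G\<^sub>i\<close> the same type, the group \<open>hat G\<^sub>i = G\<^sub>i\<close> of a regular \<open>i\<close> is represented as
  \<open>{0} \<times> G\<^sub>i\<close>. Hence for every \<open>i\<close>, free or regular, \<open>G\<^sub>i\<close> sits in \<open>hat G\<^sub>i\<close> via \<open>g \<mapsto> (0, g)\<close>.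
\<close>

definition hatG :: "('i, 'g) sys \<Rightarrow> 'i \<Rightarrow> (int \<times> 'g) monoid" where
  "hatG J i = (if i \<in> Free J then integer_group else singleton_group 0) \<times>\<times> Grp J i"

text \<open>
  The semigroup \<open>M\<^sub>i\<close>, as a subsemigroup of \<open>hat G\<^sub>i\<close>. For free \<open>i\<close> the \<open>\<one>\<close> of this record is not in the
  carrier; it is never used, since the library's \<open>hom\<close> refers only to carrier and
  multiplication, so that \<open>hom (semi J i) (Grp J j)\<close> is the set of semigroup homomorphisms.
\<close>

definition semi :: "('i, 'g) sys \<Rightarrow> 'i \<Rightarrow> (int \<times> 'g) monoid" where
  "semi J i = (hatG J i)
     \<lparr>carrier := (if i \<in> Free J then {1..} else {0}) \<times> carrier (Grp J i)\<rparr>"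

text \<open>
  The unique extension of \<open>\<phi>\<^bsub>ji\<^esub>\<close> to a group homomorphism \<open>hat G\<^sub>i \<rightarrow> G\<^sub>j\<close> (existence and uniqueness are
  shown in \<open>ex1_extension\<close> below), then \<open>hat \<phi>\<^bsub>ji\<^esub>\<close> for \<open>i \<le> j\<close> with values in \<open>hat G\<^sub>j\<close>.
\<close>

definition extPhi :: "('i, 'g) sys \<Rightarrow> 'i \<Rightarrow> 'i \<Rightarrow> int \<times> 'g \<Rightarrow> 'g" where
  "extPhi J j i = (THE f. f \<in> hom (hatG J i) (Grp J j) \<and> f \<in> extensional (carrier (hatG J i)) \<and>
                          (\<forall>x\<in>carrier (semi J i). f x = Phi J j i x))"

definition hatPhi :: "('i, 'g) sys \<Rightarrow> 'i \<Rightarrow> 'i \<Rightarrow> int \<times> 'g \<Rightarrow> int \<times> 'g" where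
  "hatPhi J j i u = (if i = j then u else (0, extPhi J j i u))"

definition I_system :: "('i, 'g) sys \<Rightarrow> bool" where
  "I_system J \<longleftrightarrow>
     partial_order_on (Idx J) (Le J) \<and>
     Free J \<union> Reg J = Idx J \<and> Free J \<inter> Reg J = {} \<and>
     (\<forall>i\<in>Idx J. comm_group (Grp J i)) \<and>
     (\<forall>i j. lt J i j \<longrightarrow> Phi J j i \<in> hom (semi J i) (Grp J j)) \<and>
     (\<forall>i j k. (i, j) \<in> Le J \<longrightarrow> (j, k) \<in> Le J \<longrightarrow>
        (\<forall>u\<in>carrier (hatG J i). hatPhi J k j (hatPhi J j i u) = hatPhi J k i u)) \<and>
     (\<forall>i\<in>Free J. \<forall>g\<in>carrier (Grp J i). \<exists>(n::nat) k x.
        (\<forall>l<n. lt J (k l) i \<and> x l \<in> carrier (semi J (k l))) \<and>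
        g = (\<Otimes>\<^bsub>Grp J i\<^esub>l\<in>{..<n}. Phi J i (k l) (x l)))"

lemma ex1_extension:
  assumes "comm_group (Grp J i)" "comm_group (Grp J j)" "Phi J j i \<in> hom (semi J i) (Grp J j)"
  shows "\<exists>!f. f \<in> hom (hatG J i) (Grp J j) \<and> f \<in> extensional (carrier (hatG J i)) \<and>
              (\<forall>x\<in>carrier (semi J i). f x = Phi J j i x)"
proof -
  interpret G: comm_group "Grp J i" by fact
  interpret H: comm_group "Grp J j" by fact
  let ?p = "Phi J j i" and ?C = "carrier (hatG J i)"
  show ?thesis
  proof (cases "i \<in> Free J")
    case False
    have C: "carrier (semi J i) = ?C"
      using False by (simp add: semi_def hatG_def)
    have "hom (semi J i) (Grp J j) = hom (hatG J i) (Grp J j)"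
      using C by (simp add: hom_def) (simp add: semi_def)
    then have p: "?p \<in> hom (hatG J i) (Grp J j)"
      using assms(3) by simp
    interpret GH: group "hatG J i"
      unfolding hatG_def using False by (intro DirProd_group) auto
    show ?thesis
    proof (rule ex1I[of _ "restrict ?p ?C"])
      show "restrict ?p ?C \<in> hom (hatG J i) (Grp J j) \<and> restrict ?p ?C \<in> extensional ?C \<and>
            (\<forall>x\<in>carrier (semi J i). restrict ?p ?C x = ?p x)"
        using p unfolding C by (auto simp: hom_def)
      show "f = restrict ?p ?C" if "f \<in> hom (hatG J i) (Grp J j) \<and> f \<in> extensional ?C \<and>
            (\<forall>x\<in>carrier (semi J i). f x = ?p x)" for f
        using that unfolding C by (auto simp: extensional_def restrict_def)
    qed
  next
    case True
    have C: "?C = UNIV \<times> carrier (Grp J i)"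
      using True by (simp add: hatG_def)
    have S: "carrier (semi J i) = {1..} \<times> carrier (Grp J i)"
      using True by (simp add: semi_def)
    have m: "(m, g) \<otimes>\<^bsub>hatG J i\<^esub> (n, h) = (m + n, g \<otimes>\<^bsub>Grp J i\<^esub> h)" for m n g h
      using True by (simp add: hatG_def)
    have mS: "(\<otimes>\<^bsub>semi J i\<^esub>) = (\<otimes>\<^bsub>hatG J i\<^esub>)"
      by (simp add: semi_def)
    have pc: "?p (n, g) \<in> carrier (Grp J j)" if "n \<ge> 1" "g \<in> carrier (Grp J i)" for n g
      using assms(3) that by (auto simp: hom_def S)
    have pm: "?p (m + n, g \<otimes>\<^bsub>Grp J i\<^esub> h) = ?p (m, g) \<otimes>\<^bsub>Grp J j\<^esub> ?p (n, h)"
      if "m \<ge> 1" "n \<ge> 1" "g \<in> carrier (Grp J i)" "h \<in> carrier (Grp J i)" for m n g h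
    proof -
      have "?p ((m, g) \<otimes>\<^bsub>semi J i\<^esub> (n, h)) = ?p (m, g) \<otimes>\<^bsub>Grp J j\<^esub> ?p (n, h)"
        using assms(3) that unfolding hom_def S by simp
      then show ?thesis by (simp add: mS m)
    qed
    define e where "e = ?p (1, \<one>\<^bsub>Grp J i\<^esub>)"
    have e: "e \<in> carrier (Grp J j)" unfolding e_def by (rule pc) auto
    have pn: "?p (n, g) = ?p (1, g) \<otimes>\<^bsub>Grp J j\<^esub> (e [^]\<^bsub>Grp J j\<^esub> (n - 1))"
      if "n \<ge> 1" "g \<in> carrier (Grp J i)" for n :: int and g
      using that
    proof (induction n rule: int_ge_induct)
      case base
      then show ?case using pc[of 1 g] by simp
    next
      case (step n)
      have "?p (n + 1, g \<otimes>\<^bsub>Grp J i\<^esub> \<one>\<^bsub>Grp J i\<^esub>) = ?p (n, g) \<otimes>\<^bsub>Grp J j\<^esub> e"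
        unfolding e_def using step by (intro pm) auto
      then have "?p (n + 1, g) = ?p (n, g) \<otimes>\<^bsub>Grp J j\<^esub> e" using step by simp
      also have "\<dots> = ?p (1, g) \<otimes>\<^bsub>Grp J j\<^esub> (e [^]\<^bsub>Grp J j\<^esub> (n - 1) \<otimes>\<^bsub>Grp J j\<^esub> e)"
        using step e pc[of 1 g] by (simp add: H.m_assoc)
      also have "e [^]\<^bsub>Grp J j\<^esub> (n - 1) \<otimes>\<^bsub>Grp J j\<^esub> e = e [^]\<^bsub>Grp J j\<^esub> (n - 1 + 1)"
        using e H.int_pow_mult[OF e, of "n - 1" 1] by simp
      finally show ?case by (simp add: algebra_simps)
    qed
    define F where
      "F = (\<lambda>x\<in>?C. ?p (1, snd x) \<otimes>\<^bsub>Grp J j\<^esub> (e [^]\<^bsub>Grp J j\<^esub> (fst x - 1)))"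
    have F: "F (n, g) = ?p (1, g) \<otimes>\<^bsub>Grp J j\<^esub> (e [^]\<^bsub>Grp J j\<^esub> (n - 1))"
      if "g \<in> carrier (Grp J i)" for n g
      using that by (simp add: F_def C)
    have Fm: "F (m + n, g \<otimes>\<^bsub>Grp J i\<^esub> h) = F (m, g) \<otimes>\<^bsub>Grp J j\<^esub> F (n, h)"
      if g: "g \<in> carrier (Grp J i)" and h: "h \<in> carrier (Grp J i)" for m n g h
    proof -
      have gh: "g \<otimes>\<^bsub>Grp J i\<^esub> h \<in> carrier (Grp J i)" using g h by simp
      have pg: "?p (1, g) \<in> carrier (Grp J j)" "?p (1, h) \<in> carrier (Grp J j)"
        "?p (1, g \<otimes>\<^bsub>Grp J i\<^esub> h) \<in> carrier (Grp J j)"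
        using pc g h gh by auto
      have "?p (1, g) \<otimes>\<^bsub>Grp J j\<^esub> ?p (1, h) = ?p (2, g \<otimes>\<^bsub>Grp J i\<^esub> h)"
        using pm[of 1 1 g h] g h by simp
      also have "\<dots> = ?p (1, g \<otimes>\<^bsub>Grp J i\<^esub> h) \<otimes>\<^bsub>Grp J j\<^esub> e"
        using pn[of 2 "g \<otimes>\<^bsub>Grp J i\<^esub> h"] gh e by simp
      finally have 1: "?p (1, g) \<otimes>\<^bsub>Grp J j\<^esub> ?p (1, h) = ?p (1, g \<otimes>\<^bsub>Grp J i\<^esub> h) \<otimes>\<^bsub>Grp J j\<^esub> e" .
      have "F (m, g) \<otimes>\<^bsub>Grp J j\<^esub> F (n, h) =
            (?p (1, g) \<otimes>\<^bsub>Grp J j\<^esub> ?p (1, h)) \<otimes>\<^bsub>Grp J j\<^esub>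
            (e [^]\<^bsub>Grp J j\<^esub> (m - 1) \<otimes>\<^bsub>Grp J j\<^esub> e [^]\<^bsub>Grp J j\<^esub> (n - 1))"
        using pg e g h by (simp add: F H.m_ac)
      also have "\<dots> = ?p (1, g \<otimes>\<^bsub>Grp J i\<^esub> h) \<otimes>\<^bsub>Grp J j\<^esub>
            (e [^]\<^bsub>Grp J j\<^esub> (1::int) \<otimes>\<^bsub>Grp J j\<^esub> e [^]\<^bsub>Grp J j\<^esub> (m - 1 + (n - 1)))"
        unfolding 1 using pg e H.int_pow_mult[OF e, of "m - 1" "n - 1"] by (simp add: H.m_assoc)
      also have "\<dots> = ?p (1, g \<otimes>\<^bsub>Grp J i\<^esub> h) \<otimes>\<^bsub>Grp J j\<^esub>
            (e [^]\<^bsub>Grp J j\<^esub> (1 + (m - 1 + (n - 1))))"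
        using H.int_pow_mult[OF e, of 1 "m - 1 + (n - 1)"] by simp
      also have "\<dots> = F (m + n, g \<otimes>\<^bsub>Grp J i\<^esub> h)"
        using gh by (simp add: F algebra_simps)
      finally show ?thesis by simp
    qed
    show ?thesis
    proof (rule ex1I[of _ F], intro conjI)
      have "F x \<in> carrier (Grp J j)" if "x \<in> ?C" for x
        using that e pc[of 1 "snd x"] by (auto simp: C F)
      moreover have "F (x \<otimes>\<^bsub>hatG J i\<^esub> y) = F x \<otimes>\<^bsub>Grp J j\<^esub> F y" if "x \<in> ?C" "y \<in> ?C" for x y
        using that by (auto simp: C m Fm)
      ultimately show "F \<in> hom (hatG J i) (Grp J j)" by (auto simp: hom_def)
      show "F \<in> extensional ?C" by (simp add: F_def)
      show "\<forall>x\<in>carrier (semi J i). F x = ?p x"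
      proof
        fix x assume "x \<in> carrier (semi J i)"
        then obtain n g where "x = (n, g)" "n \<ge> 1" "g \<in> carrier (Grp J i)" by (auto simp: S)
        then show "F x = ?p x" by (simp only: F pn[of n g])
      qed
    next
      fix f assume f: "f \<in> hom (hatG J i) (Grp J j) \<and> f \<in> extensional ?C \<and>
            (\<forall>x\<in>carrier (semi J i). f x = ?p x)"
      show "f = F"
      proof (rule extensionalityI[where A = ?C])
        show "f \<in> extensional ?C" using f by simp
        show "F \<in> extensional ?C" by (simp add: F_def)
        fix x assume "x \<in> ?C"
        then obtain n g where x: "x = (n, g)" and g: "g \<in> carrier (Grp J i)" by (auto simp: C)
        define k where "k = 1 + \<bar>n\<bar>"
        have k: "k \<ge> 1" "k + n \<ge> 1" by (auto simp: k_def)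
        have fF: "f (l, h) = F (l, h)" if "l \<ge> 1" "h \<in> carrier (Grp J i)" for l h
        proof -
          have "f (l, h) = ?p (l, h)" using f that by (simp add: S)
          then show ?thesis using that by (simp only: F pn[of l h])
        qed
        have c: "f (l, h) \<in> carrier (Grp J j)" "F (l, h) \<in> carrier (Grp J j)"
          if "h \<in> carrier (Grp J i)" for l h
          using f that e pc[of 1 h] by (auto simp: C hom_def F)
        have "f ((k, \<one>\<^bsub>Grp J i\<^esub>) \<otimes>\<^bsub>hatG J i\<^esub> (n, g)) = f (k, \<one>\<^bsub>Grp J i\<^esub>) \<otimes>\<^bsub>Grp J j\<^esub> f (n, g)"
          using f g unfolding hom_def C by simp
        then have "f (k, \<one>\<^bsub>Grp J i\<^esub>) \<otimes>\<^bsub>Grp J j\<^esub> f (n, g) = f (k + n, g)"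
          using g by (simp add: m)
        also have "\<dots> = F (k + n, g)" using fF k g by simp
        also have "\<dots> = F (k, \<one>\<^bsub>Grp J i\<^esub>) \<otimes>\<^bsub>Grp J j\<^esub> F (n, g)"
          using Fm[of "\<one>\<^bsub>Grp J i\<^esub>" g k n] g by simp
        also have "\<dots> = f (k, \<one>\<^bsub>Grp J i\<^esub>) \<otimes>\<^bsub>Grp J j\<^esub> F (n, g)"
          using fF[of k "\<one>\<^bsub>Grp J i\<^esub>"] k by simp
        finally show "f x = F x" using c g x by simp
      qed
    qed
  qed
qed

section \<open>The monoid of an \<open>I\<close>-system\<close>

definition Mx :: "('i, 'g) sys \<Rightarrow> 'i set \<Rightarrow> 'i set" where
  "Mx J a = {m \<in> a. \<forall>x\<in>a. \<not> lt J m x}"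

definition AI :: "('i, 'g) sys \<Rightarrow> 'i set set" where
  "AI J = {a. a \<subseteq> Idx J \<and> (\<forall>i j. (i, j) \<in> Le J \<longrightarrow> j \<in> a \<longrightarrow> i \<in> a) \<and>
              finite (Mx J a) \<and> (\<forall>i\<in>a. \<exists>m\<in>Mx J a. (i, m) \<in> Le J)}"

definition hatH :: "('i, 'g) sys \<Rightarrow> 'i set \<Rightarrow> ('i \<Rightarrow> int \<times> 'g) monoid" where
  "hatH J a = sum_group a (hatG J)"

definition chi :: "('i, 'g) sys \<Rightarrow> 'i set \<Rightarrow> 'i \<Rightarrow> int \<times> 'g \<Rightarrow> 'i \<Rightarrow> int \<times> 'g" where
  "chi J a i u = (\<lambda>l\<in>a. if l = i then u else \<one>\<^bsub>hatG J l\<^esub>)"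

definition U :: "('i, 'g) sys \<Rightarrow> 'i set \<Rightarrow> ('i \<Rightarrow> int \<times> 'g) set" where
  "U J a = generate (hatH J a)
     {chi J a i u \<otimes>\<^bsub>hatH J a\<^esub> inv\<^bsub>hatH J a\<^esub> (chi J a j (hatPhi J j i u)) | i j u.
        lt J i j \<and> j \<in> Mx J a \<and> u \<in> carrier (hatG J i)}"

definition H :: "('i, 'g) sys \<Rightarrow> 'i set \<Rightarrow> ('i \<Rightarrow> int \<times> 'g) set" where
  "H J a = {z \<in> carrier (hatH J a).
     (\<forall>i \<in> Mx J a \<inter> Free J. z i \<in> {1..} \<times> carrier (Grp J i)) \<and>
     (\<forall>i \<in> (a - Mx J a) \<inter> Free J. z i \<in> {(0, \<one>\<^bsub>Grp J i\<^esub>)} \<union> {1..} \<times> carrier (Grp J i))}"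

definition sim :: "('i, 'g) sys \<Rightarrow> 'i set \<Rightarrow> (('i \<Rightarrow> int \<times> 'g) \<times> ('i \<Rightarrow> int \<times> 'g)) set" where
  "sim J a = {(x, y) \<in> H J a \<times> H J a. x \<otimes>\<^bsub>hatH J a\<^esub> inv\<^bsub>hatH J a\<^esub> y \<in> U J a}"

definition emb :: "('i, 'g) sys \<Rightarrow> 'i set \<Rightarrow> 'i set \<Rightarrow> ('i \<Rightarrow> int \<times> 'g) \<Rightarrow> 'i \<Rightarrow> int \<times> 'g" where
  "emb J a b z = (\<lambda>i\<in>b. if i \<in> a then z i else \<one>\<^bsub>hatG J i\<^esub>)"

text \<open>
  The disjoint union of the \<open>M\<^sub>a = H J a // sim J a\<close> consists of the pairs \<open>(a, P)\<close> with \<open>P \<in> M\<^sub>a\<close>. In the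
  sum \<open>[x] + [y]\<close> the union over all representatives is the usual way to let an operation act on
  equivalence classes: all classes occurring in it coincide.
\<close>

definition MJ :: "('i, 'g) sys \<Rightarrow> ('i set \<times> ('i \<Rightarrow> int \<times> 'g) set) monoid" where
  "MJ J =
     \<lparr>carrier = (SIGMA a : AI J. H J a // sim J a),
      monoid.mult = (\<lambda>(a, P) (b, Q). (a \<union> b,
        \<Union>x\<in>P. \<Union>y\<in>Q. sim J (a \<union> b) ``
          {emb J a (a \<union> b) x \<otimes>\<^bsub>hatH J (a \<union> b)\<^esub> emb J b (a \<union> b) y})),
      one = ({}, sim J {} `` {\<one>\<^bsub>hatH J {}\<^esub>})\<rparr>"

end

theory Submission
  imports Defs
begin

text \<open>
  Since \<open>I\<close> is finite, everything embeds into the full direct sum \<open>hat H\<^bsub>I\<^esub>\<close>, and functoriality allows one to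
  drop the condition \<open>j \<in> Max(a)\<close> in the generators of \<open>U\<^sub>a\<close>: all \<open>j \<in> a\<close> give the same subgroup. An element of
  \<open>M(J)\<close> is then a pair \<open>(a, x + U\<^sub>a)\<close>, and sums are computed in \<open>hat H\<^bsub>I\<^esub>\<close>.

  Refinement of \<open>A + B = C + D\<close> goes by induction on the size of the common support \<open>e\<close>. Take a maximal \<open>m\<close> of \<open>e\<close>
  and split each term as \<open>A\<^sub>0 + g\<close> with \<open>A\<^sub>0\<close> supported off \<open>m\<close> and \<open>g \<in> M\<^sub>m\<close>. A relation of \<open>U\<^sub>e\<close> is one of \<open>U\<^bsub>e - {m}\<^esub>\<close>
  up to moving elements supported strictly below \<open>m\<close> into the component \<open>m\<close>; after adding such elements to
  \<open>A\<^sub>0\<close> and \<open>C\<^sub>0\<close> and subtracting their images in \<open>G\<^sub>m\<close>, both \<open>A\<^sub>0 + B\<^sub>0 = C\<^sub>0 + D\<^sub>0\<close> and the equation of the components at \<open>m\<close> hold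
  exactly. The former is refined by induction. For the latter, if all four components are present and
  the degree of \<open>g\<^sub>A\<close> is at most that of \<open>g\<^sub>C\<close>, use \<open>g\<^sub>A, 0, y, g\<^sub>D\<close> with \<open>y\<close> representing \<open>g\<^sub>C - g\<^sub>A\<close>; in degree \<open>0\<close> at a
  free \<open>m\<close> such a \<open>y\<close> exists below \<open>m\<close> by condition (c2).
\<close>

text \<open>The common term \<open>z\<close> cancels. This turns two relations that move elements at
  \<open>i\<close> and at \<open>j\<close> into the same maximal component into one relation between
  \<open>i\<close> and \<open>j\<close>.\<close>

lemma (in comm_group) div_div:
  assumes "x \<in> carrier G" "y \<in> carrier G" "z \<in> carrier G"
  shows "(x \<otimes> inv z) \<otimes> inv (y \<otimes> inv z) = x \<otimes> inv y"
proof -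
  have "inv z \<otimes> (z \<otimes> inv y) = inv y"
    using assms by (simp add: m_assoc[symmetric])
  then show ?thesis using assms by (simp add: inv_mult_group m_assoc)
qed

text \<open>The conclusion of the refinement property as a relation of its own, without the equation
  that it follows from, so that it can be permuted and multiplied. In the matrix with rows
  \<open>w, x\<close> and \<open>y, z\<close>, the row sums are \<open>a, b\<close> and the column
  sums \<open>c, d\<close>.\<close>

definition refines :: "('a, 'b) monoid_scheme \<Rightarrow> 'a \<Rightarrow> 'a \<Rightarrow> 'a \<Rightarrow> 'a \<Rightarrow> bool" where
  "refines M a b c d \<longleftrightarrow> (\<exists>w\<in>carrier M. \<exists>x\<in>carrier M. \<exists>y\<in>carrier M. \<exists>z\<in>carrier M.
     a = w \<otimes>\<^bsub>M\<^esub> x \<and> b = y \<otimes>\<^bsub>M\<^esub> z \<and> c = w \<otimes>\<^bsub>M\<^esub> y \<and> d = x \<otimes>\<^bsub>M\<^esub> z)"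

lemma refinesI:
  assumes "w \<in> carrier M" "x \<in> carrier M" "y \<in> carrier M" "z \<in> carrier M"
    "a = w \<otimes>\<^bsub>M\<^esub> x" "b = y \<otimes>\<^bsub>M\<^esub> z" "c = w \<otimes>\<^bsub>M\<^esub> y" "d = x \<otimes>\<^bsub>M\<^esub> z"
  shows "refines M a b c d"
  using assms unfolding refines_def by blast

section \<open>Permuting and multiplying refinement matrices\<close>

context comm_monoid
begin

lemma refines_transpose: "refines G a b c d \<Longrightarrow> refines G c d a b"
  unfolding refines_def by blast

lemma refines_swap: 
  assumes "refines G a b c d" shows "refines G b a c d"
proof -
  obtain w x y z where "w \<in> carrier G" "x \<in> carrier G" "y \<in> carrier G" "z \<in> carrier G"
    "a = w \<otimes> x" "b = y \<otimes> z" "c = w \<otimes> y" "d = x \<otimes> z" using assms unfolding refines_def by blast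
  then show ?thesis by (intro refinesI[of y _ z w x]) (auto simp: m_comm)
qed

lemma refines_swap': "refines G a b c d \<Longrightarrow> refines G a b d c"
  using refines_swap refines_transpose by blast

text \<open>Two refinement matrices are combined entry by entry. In the induction step this joins a
  refinement of the parts off \<open>m\<close> with one of the components at
  \<open>m\<close>.\<close>

lemma refines_mult:
  assumes "refines G a b c d" "refines G a' b' c' d'"
  shows "refines G (a \<otimes> a') (b \<otimes> b') (c \<otimes> c') (d \<otimes> d')"
proof -
  obtain w x y z where 1: "w \<in> carrier G" "x \<in> carrier G" "y \<in> carrier G" "z \<in> carrier G"
    "a = w \<otimes> x" "b = y \<otimes> z" "c = w \<otimes> y" "d = x \<otimes> z" using assms unfolding refines_def by blast
  obtain w' x' y' z' where 2: "w' \<in> carrier G" "x' \<in> carrier G" "y' \<in> carrier G" "z' \<in> carrier G"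
    "a' = w' \<otimes> x'" "b' = y' \<otimes> z'" "c' = w' \<otimes> y'" "d' = x' \<otimes> z'" using assms unfolding refines_def by blast
  show ?thesis
    by (rule refinesI[of "w \<otimes> w'" _ "x \<otimes> x'" "y \<otimes> y'" "z \<otimes> z'"]) (use 1 2 in \<open>simp_all add: m_ac\<close>)
qed

end

section \<open>Orders and groups of an \<open>I\<close>-system\<close>

locale isystem =
  fixes J :: "('i, 'g) sys"
  assumes sys: "I_system J" and fin: "finite (Idx J)"
begin

abbreviation T :: "('i \<Rightarrow> int \<times> 'g) monoid" where "T \<equiv> hatH J (Idx J)"
abbreviation X :: "'i \<Rightarrow> int \<times> 'g \<Rightarrow> 'i \<Rightarrow> int \<times> 'g" where "X \<equiv> chi J (Idx J)"

lemma partial_order: "partial_order_on (Idx J) (Le J)"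
  using sys by (simp add: I_system_def)

lemma Le_subset: "Le J \<subseteq> Idx J \<times> Idx J"
  using partial_order by (simp add: partial_order_on_def preorder_on_def)

lemma Le_refl: "i \<in> Idx J \<Longrightarrow> (i, i) \<in> Le J"
  using partial_order by (simp add: partial_order_on_def preorder_on_def refl_on_def)

lemma Le_trans: "(i, j) \<in> Le J \<Longrightarrow> (j, k) \<in> Le J \<Longrightarrow> (i, k) \<in> Le J"
  using partial_order by (auto simp: partial_order_on_def preorder_on_def dest: transD)

lemma Le_antisym: "(i, j) \<in> Le J \<Longrightarrow> (j, i) \<in> Le J \<Longrightarrow> i = j"
  using partial_order by (auto simp: partial_order_on_def dest: antisymD)

lemma lt_Idx: "lt J i j \<Longrightarrow> i \<in> Idx J" "lt J i j \<Longrightarrow> j \<in> Idx J"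
  using Le_subset by (auto simp: lt_def)

lemma lt_trans: "lt J i j \<Longrightarrow> lt J j k \<Longrightarrow> lt J i k"
  using Le_trans Le_antisym unfolding lt_def by metis

lemma Free_subset: "Free J \<subseteq> Idx J"
  using sys by (auto simp: I_system_def)

lemma comm_group_Grp: "i \<in> Idx J \<Longrightarrow> comm_group (Grp J i)"
  using sys by (simp add: I_system_def)

lemma hatG_group: 
  assumes "i \<in> Idx J" shows "comm_group (hatG J i)"
proof -
  interpret G: comm_group "Grp J i" using comm_group_Grp assms .
  show ?thesis
  proof (rule group.group_comm_groupI)
    show "Group.group (hatG J i)"
      by (auto simp: hatG_def intro!: DirProd_group)
    show "\<And>x y. x \<in> carrier (hatG J i) \<Longrightarrow> y \<in> carrier (hatG J i) \<Longrightarrow>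
      x \<otimes>\<^bsub>hatG J i\<^esub> y = y \<otimes>\<^bsub>hatG J i\<^esub> x"
      by (auto simp: hatG_def mult_DirProd' G.m_comm singleton_group_def)
  qed
qed

lemma hatG_is_group: "i \<in> Idx J \<Longrightarrow> group (hatG J i)"
  using hatG_group by (simp add: comm_group_def)

lemma one_hatG: "\<one>\<^bsub>hatG J i\<^esub> = (0, \<one>\<^bsub>Grp J i\<^esub>)"
  by (simp add: hatG_def singleton_group_def)

lemma mult_hatG: "x \<in> carrier (hatG J i) \<Longrightarrow> y \<in> carrier (hatG J i) \<Longrightarrow>
  x \<otimes>\<^bsub>hatG J i\<^esub> y = (fst x + fst y, snd x \<otimes>\<^bsub>Grp J i\<^esub> snd y)"
  by (auto simp: hatG_def mult_DirProd' singleton_group_def)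

lemma carrier_hatG: "carrier (hatG J i) = (if i \<in> Free J then UNIV else {0}) \<times> carrier (Grp J i)"
  by (simp add: hatG_def)

lemma carrier_semi: "carrier (semi J i) = (if i \<in> Free J then {1..} else {0}) \<times> carrier (Grp J i)"
  by (simp add: semi_def)

lemma semi_subset: "carrier (semi J i) \<subseteq> carrier (hatG J i)"
  by (auto simp: carrier_semi carrier_hatG)

lemma fst_mult_hatG: "x \<in> carrier (hatG J i) \<Longrightarrow> y \<in> carrier (hatG J i) \<Longrightarrow>
  fst (x \<otimes>\<^bsub>hatG J i\<^esub> y) = fst x + fst y"
  by (simp add: mult_hatG)

lemma fst_inv_hatG: 
  assumes "x \<in> carrier (hatG J i)" "i \<in> Idx J" shows "fst (inv\<^bsub>hatG J i\<^esub> x) = - fst x"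
proof -
  interpret G: comm_group "hatG J i" using hatG_group assms by simp
  have "fst (inv\<^bsub>hatG J i\<^esub> x) + fst x = fst (inv\<^bsub>hatG J i\<^esub> x \<otimes>\<^bsub>hatG J i\<^esub> x)"
    using assms by (intro fst_mult_hatG[symmetric]) auto
  also have "\<dots> = 0" using assms(1) by (subst G.l_inv) (auto simp: one_hatG)
  finally show ?thesis by simp
qed

lemma extPhi_hom:
  assumes "lt J i j" 
  shows "extPhi J j i \<in> hom (hatG J i) (Grp J j)" 
    and "x \<in> carrier (semi J i) \<Longrightarrow> extPhi J j i x = Phi J j i x"
proof -
  have "Phi J j i \<in> hom (semi J i) (Grp J j)"
    using sys assms by (simp add: I_system_def)
  from theI'[OF ex1_extension[OF comm_group_Grp comm_group_Grp this]] lt_Idx[OF assms]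
  show "extPhi J j i \<in> hom (hatG J i) (Grp J j)" 
    and "x \<in> carrier (semi J i) \<Longrightarrow> extPhi J j i x = Phi J j i x"
    by (auto simp: extPhi_def)
qed

lemma fst_hatPhi: "lt J i j \<Longrightarrow> fst (hatPhi J j i u) = 0"
  by (simp add: hatPhi_def lt_def)

lemma hatPhi_hom:
  assumes "lt J i j" 
  shows "hatPhi J j i \<in> hom (hatG J i) (hatG J j)"
proof -
  have ne: "i \<noteq> j" using assms by (simp add: lt_def)
  show ?thesis
    using extPhi_hom(1)[OF assms] ne
    by (auto simp: hom_def hatPhi_def carrier_hatG mult_hatG Pi_iff)
qed

lemma hatPhi_closed: "lt J i j \<Longrightarrow> u \<in> carrier (hatG J i) \<Longrightarrow> hatPhi J j i u \<in> carrier (hatG J j)"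
  using hatPhi_hom by (auto simp: hom_def)

lemma hatPhi_comp: "lt J i j \<Longrightarrow> lt J j k \<Longrightarrow> u \<in> carrier (hatG J i) \<Longrightarrow>
  hatPhi J k j (hatPhi J j i u) = hatPhi J k i u"
  using sys by (simp add: I_system_def lt_def)

lemma Free_generated: 
  assumes "i \<in> Free J" "g \<in> carrier (Grp J i)"
  obtains n :: nat and k x where "\<And>l. l < n \<Longrightarrow> lt J (k l) i \<and> x l \<in> carrier (semi J (k l))"
    "g = (\<Otimes>\<^bsub>Grp J i\<^esub>l\<in>{..<n}. Phi J i (k l) (x l))"
  using sys assms unfolding I_system_def by blast

section \<open>Direct sums over subsets of the index set\<close>

lemma hatH_comm_group:
  assumes "a \<subseteq> Idx J" shows "comm_group (hatH J a)"
proof (rule group.group_comm_groupI)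
  have g: "group (hatG J i)" if "i \<in> a" for i using that assms hatG_is_group by auto
  then show "group (hatH J a)" by (simp add: hatH_def)
  fix x y assume "x \<in> carrier (hatH J a)" "y \<in> carrier (hatH J a)"
  then have "x i \<otimes>\<^bsub>hatG J i\<^esub> y i = y i \<otimes>\<^bsub>hatG J i\<^esub> x i" if "i \<in> a" for i
    using that assms comm_group.axioms(1)[OF hatG_group] 
    by (auto simp: hatH_def carrier_sum_group g PiE_iff intro!: comm_monoid.m_comm)
  then show "x \<otimes>\<^bsub>hatH J a\<^esub> y = y \<otimes>\<^bsub>hatH J a\<^esub> x"
    by (auto simp: hatH_def)
qed

text \<open>Over a finite index set the finite-support condition of the direct sum is void, so the
  carrier is the full product.\<close>

lemma hatH_carrier:
  assumes "a \<subseteq> Idx J" shows "carrier (hatH J a) = (\<Pi>\<^sub>E i\<in>a. carrier (hatG J i))"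
proof -
  have "finite a" using assms fin finite_subset by auto
  moreover have "group (hatG J i)" if "i \<in> a" for i using that assms hatG_is_group by auto
  ultimately show ?thesis by (auto simp: hatH_def carrier_sum_group)
qed

lemma hatH_mult: "i \<in> a \<Longrightarrow> (x \<otimes>\<^bsub>hatH J a\<^esub> y) i = x i \<otimes>\<^bsub>hatG J i\<^esub> y i"
  by (simp add: hatH_def)

lemma hatH_one: "i \<in> a \<Longrightarrow> \<one>\<^bsub>hatH J a\<^esub> i = \<one>\<^bsub>hatG J i\<^esub>"
  by (simp add: hatH_def)

lemma hatH_inv: 
  assumes "x \<in> carrier (hatH J a)" "i \<in> a" "a \<subseteq> Idx J"
  shows "(inv\<^bsub>hatH J a\<^esub> x) i = inv\<^bsub>hatG J i\<^esub> x i"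
proof -
  have "group (hatG J i)" if "i \<in> a" for i using that assms hatG_is_group by auto
  then show ?thesis using assms by (simp add: hatH_def)
qed

lemma hatH_eqI: 
  assumes "x \<in> carrier (hatH J a)" "y \<in> carrier (hatH J a)" "a \<subseteq> Idx J" "\<And>i. i \<in> a \<Longrightarrow> x i = y i"
  shows "x = y"
  using assms by (auto simp: hatH_carrier intro: PiE_ext)

lemma hatH_comp: "x \<in> carrier (hatH J a) \<Longrightarrow> i \<in> a \<Longrightarrow> a \<subseteq> Idx J \<Longrightarrow> x i \<in> carrier (hatG J i)"
  using PiE_mem[of x a "\<lambda>i. carrier (hatG J i)"] by (simp add: hatH_carrier)

sublocale T: comm_group T
  by (rule hatH_comm_group) simp

lemma chi_closed:
  assumes "a \<subseteq> Idx J" "i \<in> a" "u \<in> carrier (hatG J i)"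
  shows "chi J a i u \<in> carrier (hatH J a)"
  using assms by (auto simp: hatH_carrier chi_def subset_iff intro!: monoid.one_closed group.is_monoid hatG_is_group)

lemma X_closed [simp]: "i \<in> Idx J \<Longrightarrow> u \<in> carrier (hatG J i) \<Longrightarrow> X i u \<in> carrier T"
  by (simp add: chi_closed)

lemma chi_apply: "l \<in> a \<Longrightarrow> chi J a i u l = (if l = i then u else \<one>\<^bsub>hatG J l\<^esub>)"
  by (simp add: chi_def)

lemma hatG_one_closed: "i \<in> Idx J \<Longrightarrow> \<one>\<^bsub>hatG J i\<^esub> \<in> carrier (hatG J i)"
  by (simp add: group.is_monoid hatG_is_group monoid.one_closed)

lemma hatG_r_one: "i \<in> Idx J \<Longrightarrow> x \<in> carrier (hatG J i) \<Longrightarrow> x \<otimes>\<^bsub>hatG J i\<^esub> \<one>\<^bsub>hatG J i\<^esub> = x"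
  by (simp add: group.is_monoid hatG_is_group monoid.r_one)

lemma hatG_m_closed: "i \<in> Idx J \<Longrightarrow> x \<in> carrier (hatG J i) \<Longrightarrow> y \<in> carrier (hatG J i) \<Longrightarrow> 
  x \<otimes>\<^bsub>hatG J i\<^esub> y \<in> carrier (hatG J i)"
  by (simp add: group.is_monoid hatG_is_group monoid.m_closed)

lemma hatG_inv_closed: "i \<in> Idx J \<Longrightarrow> x \<in> carrier (hatG J i) \<Longrightarrow> inv\<^bsub>hatG J i\<^esub> x \<in> carrier (hatG J i)"
  by (simp add: hatG_is_group group.inv_closed)

lemma hatG_inv_one: "i \<in> Idx J \<Longrightarrow> inv\<^bsub>hatG J i\<^esub> \<one>\<^bsub>hatG J i\<^esub> = \<one>\<^bsub>hatG J i\<^esub>"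
  by (simp add: group.is_monoid hatG_is_group monoid.inv_one)

lemma X_mult:
  assumes "i \<in> Idx J" "u \<in> carrier (hatG J i)" "v \<in> carrier (hatG J i)"
  shows "X i (u \<otimes>\<^bsub>hatG J i\<^esub> v) = X i u \<otimes>\<^bsub>T\<^esub> X i v"
  by (rule hatH_eqI[of _ "Idx J"])
     (use assms in \<open>auto simp: hatG_m_closed hatH_mult chi_apply hatG_r_one hatG_one_closed\<close>)

lemma X_one: "i \<in> Idx J \<Longrightarrow> X i \<one>\<^bsub>hatG J i\<^esub> = \<one>\<^bsub>T\<^esub>"
  by (rule hatH_eqI[of _ "Idx J"]) (auto simp: hatG_one_closed hatH_one chi_apply)

text \<open>Induction on the number of indices strictly above \<open>i\<close>: if \<open>i\<close>
  is not maximal in \<open>a\<close>, a strictly larger element of \<open>a\<close> has fewer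
  indices above it.\<close>

lemma exists_maximal:
  assumes "a \<subseteq> Idx J" "i \<in> a"
  shows "\<exists>m\<in>Mx J a. (i, m) \<in> Le J"
  using assms(2)
proof (induction "card {x \<in> Idx J. lt J i x}" arbitrary: i rule: less_induct)
  case less
  show ?case
  proof (cases "i \<in> Mx J a")
    case True
    then show ?thesis using less.prems assms Le_refl by blast
  next
    case False
    then obtain j where j: "j \<in> a" "lt J i j" using less.prems by (auto simp: Mx_def)
    have "{x \<in> Idx J. lt J j x} \<subseteq> {x \<in> Idx J. lt J i x}" using j lt_trans by blast
    moreover have "j \<in> {x \<in> Idx J. lt J i x} - {x \<in> Idx J. lt J j x}" 
      using j lt_Idx(2)[OF j(2)] by (auto simp: lt_def)
    ultimately have "{x \<in> Idx J. lt J j x} \<subset> {x \<in> Idx J. lt J i x}" by blast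
    then have "card {x \<in> Idx J. lt J j x} < card {x \<in> Idx J. lt J i x}"
      using fin by (simp add: psubset_card_mono)
    from less.hyps[OF this j(1)] obtain m where "m \<in> Mx J a" "(j, m) \<in> Le J" by auto
    then show ?thesis using j Le_trans by (auto simp: lt_def)
  qed
qed

text \<open>For finite \<open>I\<close> the finiteness of the set of maximal elements and the
  domination by it are automatic; what remains is being a lower set.\<close>

lemma AI_iff: "a \<in> AI J \<longleftrightarrow> a \<subseteq> Idx J \<and> (\<forall>i j. lt J i j \<longrightarrow> j \<in> a \<longrightarrow> i \<in> a)"
proof -
  have "finite (Mx J a)" if "a \<subseteq> Idx J"
    using that fin by (auto simp: Mx_def intro: finite_subset)
  then show ?thesis using exists_maximal[of a] unfolding AI_def lt_def by blast
qed

lemma AI_subset: "a \<in> AI J \<Longrightarrow> a \<subseteq> Idx J" by (simp add: AI_iff)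

lemma AI_Un: "a \<in> AI J \<Longrightarrow> b \<in> AI J \<Longrightarrow> a \<union> b \<in> AI J"
  by (auto simp: AI_iff)

section \<open>The relations inside the full direct sum\<close>

text \<open>Unlike in \<open>U\<close>, the target \<open>j\<close> runs over all of
  \<open>a\<close>, and the elements lie in the one group \<open>T\<close>. The relations therefore
  grow with \<open>a\<close>, and removing an index from \<open>a\<close> just discards the
  generators with that target.\<close>

definition gens :: "'i set \<Rightarrow> ('i \<Rightarrow> int \<times> 'g) set" where
  "gens a = {X i u \<otimes>\<^bsub>T\<^esub> inv\<^bsub>T\<^esub> (X j (hatPhi J j i u)) | i j u. 
     lt J i j \<and> j \<in> a \<and> u \<in> carrier (hatG J i)}"

definition UT :: "'i set \<Rightarrow> ('i \<Rightarrow> int \<times> 'g) set" where "UT a = generate T (gens a)"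

lemma gens_closed: "gens a \<subseteq> carrier T"
  by (auto simp: gens_def lt_Idx hatPhi_closed)

lemma subgroup_UT: "subgroup (UT a) T"
  unfolding UT_def by (rule T.generate_is_subgroup[OF gens_closed])

lemma UT_mono: "a \<subseteq> b \<Longrightarrow> UT a \<subseteq> UT b"
  unfolding UT_def by (rule T.mono_generate) (unfold gens_def, blast)

section \<open>Extension by the neutral element and restriction as homomorphisms\<close>

lemma emb_hom:
  assumes "a \<subseteq> b" "b \<subseteq> Idx J"
  shows "group_hom (hatH J a) (hatH J b) (emb J a b)"
proof -
  have a: "a \<subseteq> Idx J" using assms by simp
  interpret A: comm_group "hatH J a" by (rule hatH_comm_group[OF a])
  interpret B: comm_group "hatH J b" by (rule hatH_comm_group[OF assms(2)])
  have c: "emb J a b x \<in> carrier (hatH J b)" if "x \<in> carrier (hatH J a)" for x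
    using that assms hatG_one_closed[OF subsetD[OF assms(2)]] by (auto simp: hatH_carrier a emb_def)
  have "emb J a b \<in> hom (hatH J a) (hatH J b)"
  proof (rule homI[OF c])
    fix x y assume x: "x \<in> carrier (hatH J a)" "y \<in> carrier (hatH J a)"
    show "emb J a b (x \<otimes>\<^bsub>hatH J a\<^esub> y) = emb J a b x \<otimes>\<^bsub>hatH J b\<^esub> emb J a b y"
    proof (rule hatH_eqI[OF _ _ assms(2)])
      show "emb J a b (x \<otimes>\<^bsub>hatH J a\<^esub> y) i = (emb J a b x \<otimes>\<^bsub>hatH J b\<^esub> emb J a b y) i" if "i \<in> b" for i
        using that assms by (auto simp: hatH_mult emb_def hatG_r_one hatG_one_closed subset_iff)
    qed (auto simp: c x)
  qed simp
  then show ?thesis by (simp add: group_hom_def group_hom_axioms_def)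
qed

lemma restrict_hom:
  assumes a: "a \<subseteq> Idx J"
  shows "group_hom T (hatH J a) (\<lambda>x. restrict x a)"
proof -
  interpret A: comm_group "hatH J a" by (rule hatH_comm_group[OF a])
  have c: "restrict x a \<in> carrier (hatH J a)" if "x \<in> carrier T" for x
    using that assms hatH_comp[of x "Idx J"] by (auto simp: hatH_carrier[OF a])
  have "(\<lambda>x. restrict x a) \<in> hom T (hatH J a)"
  proof (rule homI[OF c])
    fix x y assume x: "x \<in> carrier T" "y \<in> carrier T"
    show "restrict (x \<otimes>\<^bsub>T\<^esub> y) a = restrict x a \<otimes>\<^bsub>hatH J a\<^esub> restrict y a"
    proof (rule hatH_eqI[OF _ _ a])
      show "restrict (x \<otimes>\<^bsub>T\<^esub> y) a i = (restrict x a \<otimes>\<^bsub>hatH J a\<^esub> restrict y a) i" if "i \<in> a" for i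
        using that assms by (auto simp: hatH_mult subset_iff)
    qed (auto simp: c x)
  qed simp
  then show ?thesis by (simp add: group_hom_def group_hom_axioms_def T.is_group)
qed

lemma restrict_chi: "a \<subseteq> Idx J \<Longrightarrow> restrict (X i u) a = chi J a i u"
  by (auto simp: chi_def fun_eq_iff)

lemma emb_chi: "a \<subseteq> Idx J \<Longrightarrow> i \<in> a \<Longrightarrow> emb J a (Idx J) (chi J a i u) = X i u"
  by (auto simp: chi_def emb_def fun_eq_iff)

lemma subgroup_U: 
  assumes "a \<in> AI J" shows "subgroup (U J a) (hatH J a)"
proof -
  have a: "a \<subseteq> Idx J" using assms by (simp add: AI_iff)
  interpret A: comm_group "hatH J a" by (rule hatH_comm_group[OF a])
  show ?thesis
    unfolding U_def
  proof (rule A.generate_is_subgroup, clarify)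
    fix i j u assume *: "lt J i j" "j \<in> Mx J a" "u \<in> carrier (hatG J i)"
    then have "i \<in> a" "j \<in> a" using assms by (auto simp: AI_iff Mx_def)
    then show "chi J a i u \<otimes>\<^bsub>hatH J a\<^esub> inv\<^bsub>hatH J a\<^esub> chi J a j (hatPhi J j i u) \<in> carrier (hatH J a)"
      using * a by (simp add: chi_closed hatPhi_closed)
  qed
qed

lemma emb_U:
  assumes "a \<in> AI J" "z \<in> U J a"
  shows "emb J a (Idx J) z \<in> UT a"
proof -
  have a: "a \<subseteq> Idx J" using assms by (simp add: AI_iff)
  interpret E: group_hom "hatH J a" T "emb J a (Idx J)" by (rule emb_hom[OF a]) simp
  interpret S: subgroup "UT a" T by (rule subgroup_UT)
  let ?K = "{chi J a i u \<otimes>\<^bsub>hatH J a\<^esub> inv\<^bsub>hatH J a\<^esub> (chi J a j (hatPhi J j i u)) | i j u.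
        lt J i j \<and> j \<in> Mx J a \<and> u \<in> carrier (hatG J i)}"
  have K: "?K \<subseteq> carrier (hatH J a)" and KU: "emb J a (Idx J) ` ?K \<subseteq> UT a"
  proof safe
    fix i j u assume *: "lt J i j" "j \<in> Mx J a" "u \<in> carrier (hatG J i)"
    then have ij: "i \<in> a" "j \<in> a" using assms by (auto simp: AI_iff Mx_def)
    then have c: "chi J a i u \<in> carrier (hatH J a)" "chi J a j (hatPhi J j i u) \<in> carrier (hatH J a)"
      using * a by (simp_all add: chi_closed hatPhi_closed)
    then show "chi J a i u \<otimes>\<^bsub>hatH J a\<^esub> inv\<^bsub>hatH J a\<^esub> chi J a j (hatPhi J j i u) \<in> carrier (hatH J a)"
      by simp
    have "X i u \<otimes>\<^bsub>T\<^esub> inv\<^bsub>T\<^esub> (X j (hatPhi J j i u)) \<in> UT a"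
      unfolding UT_def using * ij by (intro generate.incl) (unfold gens_def, blast)
    then show "emb J a (Idx J) (chi J a i u \<otimes>\<^bsub>hatH J a\<^esub> inv\<^bsub>hatH J a\<^esub> chi J a j (hatPhi J j i u)) \<in> UT a"
      using c a ij by (simp add: emb_chi)
  qed
  have "emb J a (Idx J) ` U J a = generate T (emb J a (Idx J) ` ?K)"
    unfolding U_def by (rule E.generate_img[OF K, symmetric])
  also have "\<dots> \<subseteq> UT a" by (rule T.generate_subgroup_incl[OF KU subgroup_UT])
  finally show ?thesis using assms by blast
qed

text \<open>The elements with all three properties form a subgroup \<open>?V\<close>, so it suffices
  to check the generators. The third property is the substantial one: it says that allowing
  nonmaximal targets \<open>j\<close> adds no new relations.\<close>

lemma UT_supp:
  assumes "a \<in> AI J" "x \<in> UT a"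
  shows "x \<in> carrier T" and "i \<in> Idx J - a \<Longrightarrow> x i = \<one>\<^bsub>hatG J i\<^esub>" and "restrict x a \<in> U J a"
proof -
  have a: "a \<subseteq> Idx J" using assms by (simp add: AI_iff)
  interpret A: comm_group "hatH J a" by (rule hatH_comm_group[OF a])
  interpret S: subgroup "U J a" "hatH J a" by (rule subgroup_U[OF assms(1)])
  interpret R: group_hom T "hatH J a" "\<lambda>x. restrict x a" by (rule restrict_hom[OF a])
  let ?V = "{x \<in> carrier T. (\<forall>i\<in>Idx J - a. x i = \<one>\<^bsub>hatG J i\<^esub>) \<and> restrict x a \<in> U J a}"
  have V: "subgroup ?V T"
  proof (rule T.subgroupI)
    show "?V \<noteq> {}" using R.hom_one hatH_one[of _ "Idx J"] by (intro ex_in_conv[THEN iffD1] exI[of _ "\<one>\<^bsub>T\<^esub>"]) simp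
  next
    fix x assume x: "x \<in> ?V"
    have "restrict (inv\<^bsub>T\<^esub> x) a = inv\<^bsub>hatH J a\<^esub> restrict x a" using x R.hom_inv by blast
    then show "inv\<^bsub>T\<^esub> x \<in> ?V"
      using x by (auto simp: hatH_inv hatG_inv_one)
  next
    fix x y assume x: "x \<in> ?V" "y \<in> ?V"
    have "restrict (x \<otimes>\<^bsub>T\<^esub> y) a = restrict x a \<otimes>\<^bsub>hatH J a\<^esub> restrict y a" using x R.hom_mult by blast
    then show "x \<otimes>\<^bsub>T\<^esub> y \<in> ?V"
      using x by (auto simp: hatH_mult hatG_r_one hatG_one_closed)
  qed auto
  have max: "chi J a i u \<otimes>\<^bsub>hatH J a\<^esub> inv\<^bsub>hatH J a\<^esub> (chi J a m (hatPhi J m i u)) \<in> U J a"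
    if "lt J i m" "m \<in> Mx J a" "u \<in> carrier (hatG J i)" for i m u
    unfolding U_def using that by (intro generate.incl) blast
  have "gens a \<subseteq> ?V"
    unfolding gens_def
  proof (safe)
    fix i j u assume *: "lt J i j" "j \<in> a" "u \<in> carrier (hatG J i)"
    have ia: "i \<in> a" using * assms(1) by (auto simp: AI_iff)
    have I: "i \<in> Idx J" "j \<in> Idx J" using a ia * by auto
    let ?v = "X i u \<otimes>\<^bsub>T\<^esub> inv\<^bsub>T\<^esub> X j (hatPhi J j i u)"
    have c: "X i u \<in> carrier T" "X j (hatPhi J j i u) \<in> carrier T"
      using * I by (auto simp: hatPhi_closed)
    then show "?v \<in> carrier T" by simp
    show "?v l = \<one>\<^bsub>hatG J l\<^esub>" if "l \<in> Idx J" "l \<notin> a" for l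
    proof -
      have "l \<noteq> i" "l \<noteq> j" using that ia * by auto
      then show ?thesis using that c
        by (simp add: hatH_mult hatH_inv chi_apply hatG_r_one hatG_one_closed hatG_inv_one)
    qed
    have eq: "restrict ?v a = chi J a i u \<otimes>\<^bsub>hatH J a\<^esub> inv\<^bsub>hatH J a\<^esub> (chi J a j (hatPhi J j i u))"
      using c R.hom_mult[of "X i u" "inv\<^bsub>T\<^esub> X j (hatPhi J j i u)"] R.hom_inv[of "X j (hatPhi J j i u)"]
      by (simp add: restrict_chi[OF a])
    obtain m where m: "m \<in> Mx J a" "(j, m) \<in> Le J" using exists_maximal[OF a] * by blast
    have ma: "m \<in> a" using m by (simp add: Mx_def)
    show "restrict ?v a \<in> U J a"
    proof (cases "j = m")
      case True
      then show ?thesis using max * m eq by simp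
    next
      case False
      \<comment> \<open>By functoriality, moving \<open>u\<close> from \<open>i\<close> to
        \<open>m\<close> directly or through \<open>j\<close> gives the same element at
        \<open>m\<close>. The relation from \<open>i\<close> to \<open>j\<close> is thus the
        difference of two relations with the maximal target \<open>m\<close>.\<close>
      then have jm: "lt J j m" using m by (simp add: lt_def)
      have im: "lt J i m" using lt_trans * jm by blast
      let ?i = "chi J a i u" and ?j = "chi J a j (hatPhi J j i u)" and ?m = "chi J a m (hatPhi J m i u)"
      have cc: "?i \<in> carrier (hatH J a)" "?j \<in> carrier (hatH J a)" "?m \<in> carrier (hatH J a)"
        using * ia ma a im by (auto simp: chi_closed hatPhi_closed)
      have "?i \<otimes>\<^bsub>hatH J a\<^esub> inv\<^bsub>hatH J a\<^esub> ?m \<in> U J a" using max im m * by blast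
      moreover have "?j \<otimes>\<^bsub>hatH J a\<^esub> inv\<^bsub>hatH J a\<^esub> ?m \<in> U J a"
        using max[OF jm m(1), of "hatPhi J j i u"] * jm by (simp add: hatPhi_comp hatPhi_closed)
      ultimately have "(?i \<otimes>\<^bsub>hatH J a\<^esub> inv\<^bsub>hatH J a\<^esub> ?m) \<otimes>\<^bsub>hatH J a\<^esub> 
          inv\<^bsub>hatH J a\<^esub> (?j \<otimes>\<^bsub>hatH J a\<^esub> inv\<^bsub>hatH J a\<^esub> ?m) \<in> U J a" by simp
      also have "(?i \<otimes>\<^bsub>hatH J a\<^esub> inv\<^bsub>hatH J a\<^esub> ?m) \<otimes>\<^bsub>hatH J a\<^esub> 
          inv\<^bsub>hatH J a\<^esub> (?j \<otimes>\<^bsub>hatH J a\<^esub> inv\<^bsub>hatH J a\<^esub> ?m) = ?i \<otimes>\<^bsub>hatH J a\<^esub> inv\<^bsub>hatH J a\<^esub> ?j"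
        using cc by (rule A.div_div)
      finally show ?thesis using eq by simp
    qed
  qed
  then have "UT a \<subseteq> ?V" unfolding UT_def by (rule T.generate_subgroup_incl[OF _ V])
  then show "x \<in> carrier T" and "i \<in> Idx J - a \<Longrightarrow> x i = \<one>\<^bsub>hatG J i\<^esub>" and "restrict x a \<in> U J a"
    using assms by blast+
qed

section \<open>The congruence modulo the relations in the full direct sum\<close>

definition eqv :: "'i set \<Rightarrow> ('i \<Rightarrow> int \<times> 'g) \<Rightarrow> ('i \<Rightarrow> int \<times> 'g) \<Rightarrow> bool" where
  "eqv a x y \<longleftrightarrow> x \<in> carrier T \<and> y \<in> carrier T \<and> x \<otimes>\<^bsub>T\<^esub> inv\<^bsub>T\<^esub> y \<in> UT a"

lemma eqv_closed: "eqv a x y \<Longrightarrow> x \<in> carrier T" "eqv a x y \<Longrightarrow> y \<in> carrier T"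
  by (auto simp: eqv_def)

lemma eqv_refl [simp]: "x \<in> carrier T \<Longrightarrow> eqv a x x"
  using subgroup.one_closed[OF subgroup_UT] by (auto simp: eqv_def)

lemma eqv_sym: 
  assumes "eqv a x y" shows "eqv a y x"
proof -
  have xy: "x \<in> carrier T" "y \<in> carrier T" "x \<otimes>\<^bsub>T\<^esub> inv\<^bsub>T\<^esub> y \<in> UT a" 
    using assms by (auto simp: eqv_def)
  have "inv\<^bsub>T\<^esub> (x \<otimes>\<^bsub>T\<^esub> inv\<^bsub>T\<^esub> y) \<in> UT a" 
    using subgroup.m_inv_closed[OF subgroup_UT xy(3)] .
  then show ?thesis using xy by (simp add: eqv_def T.inv_mult_group)
qed

lemma eqv_mult: 
  assumes "eqv a x y" "eqv a x' y'" shows "eqv a (x \<otimes>\<^bsub>T\<^esub> x') (y \<otimes>\<^bsub>T\<^esub> y')"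
proof -
  have xy: "x \<in> carrier T" "y \<in> carrier T" "x' \<in> carrier T" "y' \<in> carrier T"
    using assms by (auto simp: eqv_def)
  have "(x \<otimes>\<^bsub>T\<^esub> inv\<^bsub>T\<^esub> y) \<otimes>\<^bsub>T\<^esub> (x' \<otimes>\<^bsub>T\<^esub> inv\<^bsub>T\<^esub> y') \<in> UT a" 
    using assms by (auto simp: eqv_def intro: subgroup.m_closed[OF subgroup_UT])
  also have "(x \<otimes>\<^bsub>T\<^esub> inv\<^bsub>T\<^esub> y) \<otimes>\<^bsub>T\<^esub> (x' \<otimes>\<^bsub>T\<^esub> inv\<^bsub>T\<^esub> y') = (x \<otimes>\<^bsub>T\<^esub> x') \<otimes>\<^bsub>T\<^esub> inv\<^bsub>T\<^esub> (y \<otimes>\<^bsub>T\<^esub> y')"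
    using xy by (simp add: T.inv_mult_group T.m_ac)
  finally show ?thesis using xy by (simp add: eqv_def)
qed

lemma eqv_inv: 
  assumes "eqv a x y" shows "eqv a (inv\<^bsub>T\<^esub> x) (inv\<^bsub>T\<^esub> y)"
proof -
  have "inv\<^bsub>T\<^esub> (x \<otimes>\<^bsub>T\<^esub> inv\<^bsub>T\<^esub> y) \<in> UT a" 
    using subgroup.m_inv_closed[OF subgroup_UT] assms by (auto simp: eqv_def)
  then show ?thesis using assms by (auto simp: eqv_def T.inv_mult_group T.m_ac)
qed

lemma eqv_cancel: 
  assumes "eqv a (x \<otimes>\<^bsub>T\<^esub> z) (y \<otimes>\<^bsub>T\<^esub> z)" "x \<in> carrier T" "y \<in> carrier T" "z \<in> carrier T"
  shows "eqv a x y"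
proof -
  have "eqv a ((x \<otimes>\<^bsub>T\<^esub> z) \<otimes>\<^bsub>T\<^esub> inv\<^bsub>T\<^esub> z) ((y \<otimes>\<^bsub>T\<^esub> z) \<otimes>\<^bsub>T\<^esub> inv\<^bsub>T\<^esub> z)"
    using assms by (intro eqv_mult[OF assms(1)]) auto
  moreover have "(w \<otimes>\<^bsub>T\<^esub> z) \<otimes>\<^bsub>T\<^esub> inv\<^bsub>T\<^esub> z = w" if "w \<in> carrier T" for w
    using that assms(4) by (simp add: T.m_assoc)
  ultimately show ?thesis using assms(2,3) by simp
qed

lemma eqv_trans [trans]: 
  assumes "eqv a x y" "eqv a y z" shows "eqv a x z"
proof -
  have "eqv a (x \<otimes>\<^bsub>T\<^esub> y) (z \<otimes>\<^bsub>T\<^esub> y)" 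
    using eqv_mult[OF assms] eqv_closed[OF assms(1)] eqv_closed[OF assms(2)] by (simp add: T.m_comm)
  then show ?thesis using eqv_cancel eqv_closed assms by blast
qed

lemma eqv_mono: "eqv a x y \<Longrightarrow> a \<subseteq> b \<Longrightarrow> eqv b x y"
  using UT_mono by (auto simp: eqv_def)

lemma eqv_X:
  assumes "lt J i j" "j \<in> a" "u \<in> carrier (hatG J i)"
  shows "eqv a (X i u) (X j (hatPhi J j i u))"
proof -
  have "X i u \<otimes>\<^bsub>T\<^esub> inv\<^bsub>T\<^esub> X j (hatPhi J j i u) \<in> gens a"
    using assms unfolding gens_def by blast
  then show ?thesis using assms lt_Idx[OF assms(1)]
    by (auto simp: eqv_def UT_def hatPhi_closed intro: generate.incl)
qed

text \<open>An element that is trivial off \<open>a\<close> is recovered from its restriction by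
  \<open>emb\<close>. Hence \<open>emb_U\<close> gives one direction and \<open>UT_supp\<close> the
  other.\<close>

lemma eqv_iff_U:
  assumes "a \<in> AI J" "x \<in> carrier T" "y \<in> carrier T" 
    "\<And>i. i \<in> Idx J - a \<Longrightarrow> x i = \<one>\<^bsub>hatG J i\<^esub>" "\<And>i. i \<in> Idx J - a \<Longrightarrow> y i = \<one>\<^bsub>hatG J i\<^esub>"
  shows "eqv a x y \<longleftrightarrow> restrict x a \<otimes>\<^bsub>hatH J a\<^esub> inv\<^bsub>hatH J a\<^esub> restrict y a \<in> U J a"
proof -
  have a: "a \<subseteq> Idx J" using assms by (simp add: AI_iff)
  interpret A: comm_group "hatH J a" by (rule hatH_comm_group[OF a])
  interpret R: group_hom T "hatH J a" "\<lambda>x. restrict x a" by (rule restrict_hom[OF a])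
  let ?v = "x \<otimes>\<^bsub>T\<^esub> inv\<^bsub>T\<^esub> y"
  have v: "?v \<in> carrier T" using assms by simp
  have r: "restrict ?v a = restrict x a \<otimes>\<^bsub>hatH J a\<^esub> inv\<^bsub>hatH J a\<^esub> restrict y a"
    using R.hom_mult[of x "inv\<^bsub>T\<^esub> y"] R.hom_inv[of y] assms by simp
  have "emb J a (Idx J) (restrict ?v a) = ?v"
  proof (rule hatH_eqI[of _ "Idx J"])
    interpret E: group_hom "hatH J a" T "emb J a (Idx J)" by (rule emb_hom[OF a]) simp
    show "emb J a (Idx J) (restrict ?v a) \<in> carrier T" using E.hom_closed R.hom_closed[OF v] by blast
    show "emb J a (Idx J) (restrict ?v a) i = ?v i" if "i \<in> Idx J" for i
      using that assms hatH_inv[OF R.hom_closed _ a, of y i] a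
      by (auto simp: emb_def hatH_mult hatH_inv hatG_inv_one hatG_r_one hatG_one_closed)
  qed (use v in auto)
  then have "?v \<in> UT a" if "restrict ?v a \<in> U J a" using emb_U[OF assms(1) that] by simp
  then have "?v \<in> UT a \<longleftrightarrow> restrict ?v a \<in> U J a" using UT_supp(3)[OF assms(1)] by blast
  then show ?thesis using assms r by (simp add: eqv_def)
qed

section \<open>Elements of the monoid\<close>

text \<open>The semigroup \<open>H J a\<close> extended by neutral components to all of
  \<open>I\<close>. Its two conditions on free indices are merged: the degree is positive, or the
  component is trivial and the index is not maximal. Membership of the second coordinates in the
  groups is already part of lying in \<open>T\<close>.\<close>

definition HT :: "'i set \<Rightarrow> ('i \<Rightarrow> int \<times> 'g) set" where
  "HT a = {x \<in> carrier T. (\<forall>i\<in>Idx J - a. x i = \<one>\<^bsub>hatG J i\<^esub>) \<and>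
     (\<forall>i\<in>a \<inter> Free J. x i = \<one>\<^bsub>hatG J i\<^esub> \<and> i \<notin> Mx J a \<or> fst (x i) \<ge> 1)}"

lemma HT_closed: "x \<in> HT a \<Longrightarrow> x \<in> carrier T"
  by (simp add: HT_def)

lemma HT_off: "x \<in> HT a \<Longrightarrow> i \<in> Idx J \<Longrightarrow> i \<notin> a \<Longrightarrow> x i = \<one>\<^bsub>hatG J i\<^esub>"
  by (simp add: HT_def)

lemma HT_restrict:
  assumes "a \<in> AI J" "x \<in> carrier T" "\<forall>i\<in>Idx J - a. x i = \<one>\<^bsub>hatG J i\<^esub>"
  shows "x \<in> HT a \<longleftrightarrow> restrict x a \<in> H J a"
proof -
  have a: "a \<subseteq> Idx J" using assms by (simp add: AI_iff)
  interpret R: group_hom T "hatH J a" "\<lambda>x. restrict x a" by (rule restrict_hom[OF a])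
  have r: "restrict x a \<in> carrier (hatH J a)" using R.hom_closed assms by blast
  have pos: "x i \<in> {1..} \<times> carrier (Grp J i) \<longleftrightarrow> fst (x i) \<ge> 1" if "i \<in> a \<inter> Free J" for i
    using hatH_comp[OF assms(2), of i] that a by (cases "x i") (auto simp: carrier_hatG)
  have Mxa: "Mx J a \<subseteq> a" by (auto simp: Mx_def)
  have 1: "(\<forall>i\<in>a \<inter> Free J. x i = \<one>\<^bsub>hatG J i\<^esub> \<and> i \<notin> Mx J a \<or> fst (x i) \<ge> 1) \<longleftrightarrow>
     (\<forall>i \<in> Mx J a \<inter> Free J. fst (x i) \<ge> 1) \<and> (\<forall>i \<in> (a - Mx J a) \<inter> Free J. x i = \<one>\<^bsub>hatG J i\<^esub> \<or> fst (x i) \<ge> 1)"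
    using Mxa by blast
  have 2: "(\<forall>i \<in> Mx J a \<inter> Free J. restrict x a i \<in> {1..} \<times> carrier (Grp J i)) \<longleftrightarrow> 
     (\<forall>i \<in> Mx J a \<inter> Free J. fst (x i) \<ge> 1)"
    using Mxa pos by (intro ball_cong) auto
  have 3: "(\<forall>i \<in> (a - Mx J a) \<inter> Free J. restrict x a i \<in> {(0, \<one>\<^bsub>Grp J i\<^esub>)} \<union> {1..} \<times> carrier (Grp J i)) \<longleftrightarrow> 
     (\<forall>i \<in> (a - Mx J a) \<inter> Free J. x i = \<one>\<^bsub>hatG J i\<^esub> \<or> fst (x i) \<ge> 1)"
    using pos by (intro ball_cong) (auto simp: one_hatG)
  show ?thesis
    unfolding HT_def H_def mem_Collect_eq 1 2 3 using assms r by blast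
qed

lemma HT_eqv_iff_sim:
  assumes "a \<in> AI J" "x \<in> HT a" "y \<in> HT a"
  shows "eqv a x y \<longleftrightarrow> (restrict x a, restrict y a) \<in> sim J a"
  using assms eqv_iff_U[OF assms(1), of x y] HT_restrict[OF assms(1), of x] HT_restrict[OF assms(1), of y]
  by (auto simp: sim_def HT_def)

lemma H_obtain:
  assumes "a \<in> AI J" "z \<in> H J a"
  obtains x where "x \<in> HT a" "z = restrict x a"
proof -
  have a: "a \<subseteq> Idx J" using assms by (simp add: AI_iff)
  have z: "z \<in> carrier (hatH J a)" using assms by (simp add: H_def)
  interpret E: group_hom "hatH J a" T "emb J a (Idx J)" by (rule emb_hom[OF a]) simp
  have 1: "emb J a (Idx J) z \<in> carrier T" using E.hom_closed z by blast
  have 2: "\<forall>i\<in>Idx J - a. emb J a (Idx J) z i = \<one>\<^bsub>hatG J i\<^esub>" by (simp add: emb_def)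
  have "z \<in> extensional a" using z by (simp add: hatH_carrier[OF a] PiE_def)
  then have 3: "z = restrict (emb J a (Idx J) z) a"
    using a by (auto simp: emb_def fun_eq_iff extensional_def)
  have "emb J a (Idx J) z \<in> HT a" using HT_restrict[OF assms(1) 1 2] 3 assms by simp
  then show ?thesis using 3 that by blast
qed

text \<open>The three properties are inherited from \<open>eqv\<close>, after each element of
  \<open>H J a\<close> has been written as the restriction of an element of
  \<open>HT a\<close>.\<close>

lemma equiv_sim:
  assumes "a \<in> AI J" shows "equiv (H J a) (sim J a)"
proof (rule equivI)
  show "refl_on (H J a) (sim J a)"
  proof (rule refl_onI)
    fix z assume "z \<in> H J a"
    then obtain x where x: "x \<in> HT a" "z = restrict x a" by (rule H_obtain[OF assms])
    then show "(z, z) \<in> sim J a" 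
      using HT_eqv_iff_sim[OF assms x(1) x(1)] eqv_refl[OF HT_closed[OF x(1)]] by simp
  qed
  show "sim J a \<subseteq> H J a \<times> H J a" by (auto simp: sim_def)
  show "sym (sim J a)"
  proof (rule symI)
    fix z z' assume *: "(z, z') \<in> sim J a"
    then have z: "z \<in> H J a" "z' \<in> H J a" by (auto simp: sim_def)
    obtain x where x: "x \<in> HT a" "z = restrict x a" by (rule H_obtain[OF assms z(1)])
    obtain x' where x': "x' \<in> HT a" "z' = restrict x' a" by (rule H_obtain[OF assms z(2)])
    show "(z', z) \<in> sim J a" 
      using HT_eqv_iff_sim[OF assms x(1) x'(1)] HT_eqv_iff_sim[OF assms x'(1) x(1)] eqv_sym[of a x x'] * x x' 
      by simp
  qed
  show "trans (sim J a)"
  proof (rule transI)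
    fix z z' z'' assume *: "(z, z') \<in> sim J a" "(z', z'') \<in> sim J a"
    then have z: "z \<in> H J a" "z' \<in> H J a" "z'' \<in> H J a" by (auto simp: sim_def)
    obtain x where x: "x \<in> HT a" "z = restrict x a" by (rule H_obtain[OF assms z(1)])
    obtain x' where x': "x' \<in> HT a" "z' = restrict x' a" by (rule H_obtain[OF assms z(2)])
    obtain x'' where x'': "x'' \<in> HT a" "z'' = restrict x'' a" by (rule H_obtain[OF assms z(3)])
    have "eqv a x x'" "eqv a x' x''" 
      using HT_eqv_iff_sim[OF assms x(1) x'(1)] HT_eqv_iff_sim[OF assms x'(1) x''(1)] * x x' x'' by simp_all
    then have "eqv a x x''" by (rule eqv_trans)
    then show "(z, z'') \<in> sim J a" using HT_eqv_iff_sim[OF assms x(1) x''(1)] x x'' by simp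
  qed
qed

section \<open>Classes of representatives and their sums\<close>

definition cls :: "'i set \<Rightarrow> ('i \<Rightarrow> int \<times> 'g) \<Rightarrow> 'i set \<times> ('i \<Rightarrow> int \<times> 'g) set" where
  "cls a x = (a, sim J a `` {restrict x a})"

lemma cls_eq_iff:
  assumes "a \<in> AI J" "x \<in> HT a" "y \<in> HT b"
  shows "cls a x = cls b y \<longleftrightarrow> a = b \<and> eqv a x y"
proof (cases "a = b")
  case True
  then have "restrict x a \<in> H J a" "restrict y a \<in> H J a" 
    using assms HT_restrict[OF assms(1)] by (auto simp: HT_def)
  then show ?thesis using True assms HT_eqv_iff_sim eq_equiv_class_iff[OF equiv_sim[OF assms(1)]]
    by (simp add: cls_def)
qed (simp add: cls_def)

lemma MJ_carrier: "carrier (MJ J) = {cls a x |a x. a \<in> AI J \<and> x \<in> HT a}"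
proof (rule equalityI; rule subsetI)
  fix p assume p: "p \<in> carrier (MJ J)"
  then have a: "fst p \<in> AI J" and "snd p \<in> H J (fst p) // sim J (fst p)" by (auto simp: MJ_def)
  then obtain z where z: "z \<in> H J (fst p)" "snd p = sim J (fst p) `` {z}" by (auto simp: quotient_def)
  obtain x where "x \<in> HT (fst p)" "z = restrict x (fst p)" by (rule H_obtain[OF a z(1)])
  then have "p = cls (fst p) x" using z by (simp add: cls_def prod_eq_iff)
  then show "p \<in> {cls a x |a x. a \<in> AI J \<and> x \<in> HT a}" using a \<open>x \<in> HT (fst p)\<close> by blast
next
  fix p assume "p \<in> {cls a x |a x. a \<in> AI J \<and> x \<in> HT a}"
  then obtain a x where ax: "p = cls a x" "a \<in> AI J" "x \<in> HT a" by blast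
  then have "restrict x a \<in> H J a" using HT_restrict by (auto simp: HT_def)
  then show "p \<in> carrier (MJ J)" 
    using ax by (auto simp: MJ_def cls_def quotient_def)
qed

lemma cls_closed: "a \<in> AI J \<Longrightarrow> x \<in> HT a \<Longrightarrow> cls a x \<in> carrier (MJ J)"
  by (auto simp: MJ_carrier)

text \<open>Degrees at free indices are nonnegative, and degree zero means a trivial component. If
  the degree of the sum vanishes at \<open>i\<close>, both components are therefore trivial there.
  Such an \<open>i\<close> is not maximal in the union, since a maximal element of
  \<open>a \<union> b\<close> is maximal in each of the two sets that contains it.\<close>

lemma HT_mult:
  assumes "a \<in> AI J" "b \<in> AI J" "x \<in> HT a" "y \<in> HT b"
  shows "x \<otimes>\<^bsub>T\<^esub> y \<in> HT (a \<union> b)"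
proof -
  have c: "x \<in> carrier T" "y \<in> carrier T" using assms HT_closed by auto
  have nn: "fst (z i) \<ge> 0 \<and> (fst (z i) = 0 \<longrightarrow> z i = \<one>\<^bsub>hatG J i\<^esub>)" if "z \<in> HT e" "i \<in> Free J" for z e i
  proof -
    have "z i = \<one>\<^bsub>hatG J i\<^esub> \<or> fst (z i) \<ge> 1" using that Free_subset by (auto simp: HT_def)
    then show ?thesis by (auto simp: one_hatG)
  qed
  have "(x \<otimes>\<^bsub>T\<^esub> y) i = \<one>\<^bsub>hatG J i\<^esub> \<and> i \<notin> Mx J (a \<union> b) \<or> fst ((x \<otimes>\<^bsub>T\<^esub> y) i) \<ge> 1" 
    if i: "i \<in> (a \<union> b) \<inter> Free J" for i
  proof -
    have iI: "i \<in> Idx J" using i Free_subset by auto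
    have f: "fst ((x \<otimes>\<^bsub>T\<^esub> y) i) = fst (x i) + fst (y i)"
      using iI c by (simp add: hatH_mult fst_mult_hatG hatH_comp)
    show ?thesis
    proof (cases "fst (x i) + fst (y i) \<ge> 1")
      case False
      then have z: "fst (x i) = 0" "fst (y i) = 0" using nn[OF assms(3), of i] nn[OF assms(4), of i] i by auto
      then have "(x \<otimes>\<^bsub>T\<^esub> y) i = \<one>\<^bsub>hatG J i\<^esub>"
        using nn[OF assms(3), of i] nn[OF assms(4), of i] i iI by (simp add: hatH_mult hatG_r_one hatG_one_closed)
      moreover have "i \<notin> Mx J (a \<union> b)"
      proof
        assume "i \<in> Mx J (a \<union> b)"
        then have "i \<in> Mx J a \<or> i \<in> Mx J b" by (auto simp: Mx_def)
        moreover have "i \<notin> Mx J a" using assms(3) z i by (auto simp: HT_def Mx_def)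
        moreover have "i \<notin> Mx J b" using assms(4) z i by (auto simp: HT_def Mx_def)
        ultimately show False by blast
      qed
      ultimately show ?thesis by simp
    qed (simp add: f)
  qed
  moreover have "(x \<otimes>\<^bsub>T\<^esub> y) i = \<one>\<^bsub>hatG J i\<^esub>" if "i \<in> Idx J - (a \<union> b)" for i
    using that assms by (simp add: HT_off hatH_mult hatG_r_one hatG_one_closed)
  ultimately show ?thesis using c by (simp add: HT_def)
qed

text \<open>Congruences for \<open>a\<close> and for \<open>b\<close> both persist in
  \<open>a \<union> b\<close> by \<open>eqv_mono\<close>. All the sets in the union over
  representatives therefore coincide, and the sum can be computed in \<open>T\<close>.\<close>

lemma cls_mult:
  assumes "a \<in> AI J" "b \<in> AI J" "x \<in> HT a" "y \<in> HT b"
  shows "cls a x \<otimes>\<^bsub>MJ J\<^esub> cls b y = cls (a \<union> b) (x \<otimes>\<^bsub>T\<^esub> y)"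
proof -
  let ?e = "a \<union> b"
  have e: "?e \<in> AI J" using assms AI_Un by blast
  have abI: "?e \<subseteq> Idx J" using AI_subset[OF e] .
  have rep: "\<exists>x'\<in>HT c. p = restrict x' c \<and> eqv c x x'" 
    if c: "c \<in> AI J" "x \<in> HT c" "p \<in> sim J c `` {restrict x c}" for c x p
  proof -
    have s: "(restrict x c, p) \<in> sim J c" using c by simp
    then have p: "p \<in> H J c" by (auto simp: sim_def)
    obtain x' where x': "x' \<in> HT c" "p = restrict x' c" by (rule H_obtain[OF c(1) p])
    then have "eqv c x x'" using HT_eqv_iff_sim[OF c(1,2) x'(1)] s by simp
    then show ?thesis using x' by blast
  qed
  have add: "emb J a ?e (restrict x' a) \<otimes>\<^bsub>hatH J ?e\<^esub> emb J b ?e (restrict y' b) = restrict (x' \<otimes>\<^bsub>T\<^esub> y') ?e"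
    if "x' \<in> HT a" "y' \<in> HT b" for x' y'
  proof -
    have "emb J a ?e (restrict x' a) = restrict x' ?e" "emb J b ?e (restrict y' b) = restrict y' ?e"
      using HT_off[OF that(1)] HT_off[OF that(2)] abI by (auto simp: emb_def fun_eq_iff)
    moreover have "restrict (x' \<otimes>\<^bsub>T\<^esub> y') ?e = restrict x' ?e \<otimes>\<^bsub>hatH J ?e\<^esub> restrict y' ?e"
      using group_hom.hom_mult[OF restrict_hom[OF abI] HT_closed[OF that(1)] HT_closed[OF that(2)]] .
    ultimately show ?thesis by simp
  qed
  let ?C = "sim J ?e `` {restrict (x \<otimes>\<^bsub>T\<^esub> y) ?e}"
  have all: "sim J ?e `` {emb J a ?e p \<otimes>\<^bsub>hatH J ?e\<^esub> emb J b ?e q} = ?C"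
    if pq: "p \<in> sim J a `` {restrict x a}" "q \<in> sim J b `` {restrict y b}" for p q
  proof -
    obtain x' where x': "x' \<in> HT a" "p = restrict x' a" "eqv a x x'" using rep[OF assms(1,3) pq(1)] by auto
    obtain y' where y': "y' \<in> HT b" "q = restrict y' b" "eqv b y y'" using rep[OF assms(2,4) pq(2)] by auto
    have "eqv ?e (x' \<otimes>\<^bsub>T\<^esub> y') (x \<otimes>\<^bsub>T\<^esub> y)"
      by (rule eqv_mult[OF eqv_sym[OF eqv_mono[OF x'(3)]] eqv_sym[OF eqv_mono[OF y'(3)]]]) auto
    then have "cls ?e (x' \<otimes>\<^bsub>T\<^esub> y') = cls ?e (x \<otimes>\<^bsub>T\<^esub> y)"
      using cls_eq_iff[OF e HT_mult[OF assms(1,2) x'(1) y'(1)] HT_mult[OF assms]] by simp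
    then show ?thesis using add x' y' by (simp add: cls_def)
  qed
  have "restrict x a \<in> sim J a `` {restrict x a}" "restrict y b \<in> sim J b `` {restrict y b}"
    using HT_eqv_iff_sim[OF assms(1,3,3)] HT_eqv_iff_sim[OF assms(2,4,4)] 
      HT_closed[OF assms(3)] HT_closed[OF assms(4)] by simp_all
  then have ne: "sim J a `` {restrict x a} \<noteq> {}" "sim J b `` {restrict y b} \<noteq> {}" by blast+
  have "(\<Union>p\<in>sim J a `` {restrict x a}. \<Union>q\<in>sim J b `` {restrict y b}. 
       sim J ?e `` {emb J a ?e p \<otimes>\<^bsub>hatH J ?e\<^esub> emb J b ?e q}) = ?C"
    by (intro SUP_eq_const ne all)
  then show ?thesis by (simp add: MJ_def cls_def)
qed

section \<open>The commutative monoid and its conicality\<close>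

lemma HT_one: "\<one>\<^bsub>T\<^esub> \<in> HT {}"
  by (simp add: HT_def hatH_one)

lemma HT_empty: 
  assumes "x \<in> HT {}" shows "x = \<one>\<^bsub>T\<^esub>"
  by (rule hatH_eqI[of _ "Idx J"]) (use assms in \<open>auto simp: HT_def hatH_one\<close>)

lemma AI_empty: "{} \<in> AI J"
  by (simp add: AI_iff)

lemma cls_one: "\<one>\<^bsub>MJ J\<^esub> = cls {} \<one>\<^bsub>T\<^esub>"
  by (simp add: MJ_def cls_def hatH_def)

lemma MJ_obtain: 
  assumes "A \<in> carrier (MJ J)" obtains a x where "A = cls a x" "a \<in> AI J" "x \<in> HT a"
  using assms by (auto simp: MJ_carrier)

sublocale M: comm_monoid "MJ J"
proof (rule comm_monoidI)
  fix A B assume A: "A \<in> carrier (MJ J)" and B: "B \<in> carrier (MJ J)"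
  obtain a x where a: "A = cls a x" "a \<in> AI J" "x \<in> HT a" by (rule MJ_obtain[OF A])
  obtain b y where b: "B = cls b y" "b \<in> AI J" "y \<in> HT b" by (rule MJ_obtain[OF B])
  show "A \<otimes>\<^bsub>MJ J\<^esub> B \<in> carrier (MJ J)" using a b by (simp add: cls_mult cls_closed HT_mult AI_Un)
  show "A \<otimes>\<^bsub>MJ J\<^esub> B = B \<otimes>\<^bsub>MJ J\<^esub> A" 
    using a b T.m_comm[OF HT_closed[OF a(3)] HT_closed[OF b(3)]] by (simp add: cls_mult Un_commute)
next
  fix A B C assume A: "A \<in> carrier (MJ J)" and B: "B \<in> carrier (MJ J)" and C: "C \<in> carrier (MJ J)"
  obtain a x where a: "A = cls a x" "a \<in> AI J" "x \<in> HT a" by (rule MJ_obtain[OF A])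
  obtain b y where b: "B = cls b y" "b \<in> AI J" "y \<in> HT b" by (rule MJ_obtain[OF B])
  obtain c z where c: "C = cls c z" "c \<in> AI J" "z \<in> HT c" by (rule MJ_obtain[OF C])
  show "(A \<otimes>\<^bsub>MJ J\<^esub> B) \<otimes>\<^bsub>MJ J\<^esub> C = A \<otimes>\<^bsub>MJ J\<^esub> (B \<otimes>\<^bsub>MJ J\<^esub> C)"
    using a b c T.m_assoc[OF HT_closed[OF a(3)] HT_closed[OF b(3)] HT_closed[OF c(3)]]
    by (simp add: cls_mult HT_mult AI_Un Un_assoc)
next
  fix A assume A: "A \<in> carrier (MJ J)"
  obtain a x where a: "A = cls a x" "a \<in> AI J" "x \<in> HT a" by (rule MJ_obtain[OF A])
  then show "\<one>\<^bsub>MJ J\<^esub> \<otimes>\<^bsub>MJ J\<^esub> A = A" 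
    using T.l_one[OF HT_closed[OF a(3)]] by (simp add: cls_one cls_mult AI_empty HT_one)
qed (simp add: cls_one cls_closed AI_empty HT_one)

text \<open>The support of a sum is the union of the supports, so both supports are empty; over the
  empty support there is only the neutral element.\<close>

lemma conical: "conical_monoid (MJ J)"
  unfolding conical_monoid_def
proof (intro conjI ballI impI)
  show "comm_monoid (MJ J)" by unfold_locales
  fix A B assume A: "A \<in> carrier (MJ J)" and B: "B \<in> carrier (MJ J)" and 1: "A \<otimes>\<^bsub>MJ J\<^esub> B = \<one>\<^bsub>MJ J\<^esub>"
  obtain a x where a: "A = cls a x" "a \<in> AI J" "x \<in> HT a" by (rule MJ_obtain[OF A])
  obtain b y where b: "B = cls b y" "b \<in> AI J" "y \<in> HT b" by (rule MJ_obtain[OF B])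
  have "a = {}" "b = {}"
    using 1 a b by (auto simp: cls_mult cls_one cls_eq_iff AI_Un HT_mult HT_one AI_empty)
  then show "A = \<one>\<^bsub>MJ J\<^esub>" "B = \<one>\<^bsub>MJ J\<^esub>" using a b HT_empty by (auto simp: cls_one)
qed

section \<open>The components below a maximal index\<close>

definition down :: "'i \<Rightarrow> 'i set" where "down m = {i. (i, m) \<in> Le J}"

definition sdown :: "'i \<Rightarrow> 'i set" where "sdown m = {i. lt J i m}"

text \<open>The image of an element of the semigroup of \<open>m\<close> in the monoid. Supports are
  lower sets, so the support has to be all of \<open>down m\<close> although only the component at
  \<open>m\<close> is prescribed.\<close>

definition principal :: "'i \<Rightarrow> int \<times> 'g \<Rightarrow> 'i set \<times> ('i \<Rightarrow> int \<times> 'g) set" where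
  "principal m g = cls (down m) (X m g)"

definition G0 :: "'i \<Rightarrow> (int \<times> 'g) set" where
  "G0 m = {0} \<times> carrier (Grp J m)"

section \<open>Lower sets of an index and computations in its semigroup\<close>

lemma down_eq: "m \<in> Idx J \<Longrightarrow> down m = insert m (sdown m)"
  using Le_refl by (auto simp: down_def sdown_def lt_def)

lemma sdown_irrefl: "m \<notin> sdown m"
  by (simp add: sdown_def lt_def)

lemma down_AI: "down m \<in> AI J"
  using Le_subset Le_trans by (auto simp: AI_iff down_def lt_def)

lemma sdown_AI: "sdown m \<in> AI J"
  using lt_Idx lt_trans by (auto simp: AI_iff sdown_def)

lemma sdown_subset: "a \<in> AI J \<Longrightarrow> m \<in> a \<Longrightarrow> sdown m \<subseteq> a"
  by (auto simp: AI_iff sdown_def)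

lemma AI_remove: "a \<in> AI J \<Longrightarrow> m \<in> Mx J a \<Longrightarrow> a - {m} \<in> AI J"
  by (auto simp: AI_iff Mx_def)

lemma G0_iff: "h \<in> G0 m \<longleftrightarrow> h \<in> carrier (hatG J m) \<and> fst h = 0"
  by (cases h) (auto simp: G0_def carrier_hatG)

lemma semi_iff: "g \<in> carrier (semi J m) \<longleftrightarrow> g \<in> carrier (hatG J m) \<and> (m \<in> Free J \<longrightarrow> fst g \<ge> 1)"
  by (cases g) (auto simp: carrier_semi carrier_hatG)

lemma semi_hatG: "g \<in> carrier (semi J m) \<Longrightarrow> g \<in> carrier (hatG J m)"
  using semi_subset by blast

lemma semi_mult:
  "m \<in> Idx J \<Longrightarrow> g \<in> carrier (semi J m) \<Longrightarrow> h \<in> carrier (hatG J m) \<Longrightarrow> m \<in> Free J \<longrightarrow> fst h \<ge> 0 \<Longrightarrow> 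
   g \<otimes>\<^bsub>hatG J m\<^esub> h \<in> carrier (semi J m)"
  by (auto simp: semi_iff hatG_m_closed fst_mult_hatG)

lemma semi_mult_G0:
  "m \<in> Idx J \<Longrightarrow> g \<in> carrier (semi J m) \<Longrightarrow> h \<in> G0 m \<Longrightarrow> g \<otimes>\<^bsub>hatG J m\<^esub> h \<in> carrier (semi J m)"
  by (simp add: semi_mult G0_iff)

lemma semi_mult_semi:
  "m \<in> Idx J \<Longrightarrow> g \<in> carrier (semi J m) \<Longrightarrow> h \<in> carrier (semi J m) \<Longrightarrow> 
   g \<otimes>\<^bsub>hatG J m\<^esub> h \<in> carrier (semi J m)"
  by (auto simp: semi_iff hatG_m_closed fst_mult_hatG)

lemma G0_mult: "m \<in> Idx J \<Longrightarrow> g \<in> G0 m \<Longrightarrow> h \<in> G0 m \<Longrightarrow> g \<otimes>\<^bsub>hatG J m\<^esub> h \<in> G0 m"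
  by (simp add: G0_iff hatG_m_closed fst_mult_hatG)

lemma G0_inv: "m \<in> Idx J \<Longrightarrow> g \<in> G0 m \<Longrightarrow> inv\<^bsub>hatG J m\<^esub> g \<in> G0 m"
  by (simp add: G0_iff hatG_inv_closed fst_inv_hatG)

lemma G0_one: "m \<in> Idx J \<Longrightarrow> \<one>\<^bsub>hatG J m\<^esub> \<in> G0 m"
  by (simp add: G0_iff hatG_one_closed) (simp add: one_hatG)

lemma HT_I:
  assumes "x \<in> carrier T" "\<And>i. i \<in> Idx J \<Longrightarrow> i \<notin> a \<Longrightarrow> x i = \<one>\<^bsub>hatG J i\<^esub>" 
    "\<And>i. i \<in> a \<Longrightarrow> i \<in> Free J \<Longrightarrow> fst (x i) \<ge> 1"
  shows "x \<in> HT a"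
  using assms by (simp add: HT_def)

text \<open>The trivial components below \<open>m\<close> are admissible because \<open>m\<close> is
  the only maximal element of \<open>down m\<close>.\<close>

lemma X_HT:
  assumes "m \<in> Idx J" "g \<in> carrier (semi J m)" shows "X m g \<in> HT (down m)"
proof -
  have m: "m \<in> down m" using assms by (simp add: down_eq)
  have "X m g i = \<one>\<^bsub>hatG J i\<^esub> \<and> i \<notin> Mx J (down m) \<or> fst (X m g i) \<ge> 1" if i: "i \<in> down m \<inter> Free J" for i
  proof (cases "i = m")
    case True
    then show ?thesis using i assms by (simp add: chi_apply semi_iff)
  next
    case False
    then have "lt J i m" using i by (simp add: down_def lt_def)
    then show ?thesis using m i False Free_subset by (auto simp: chi_apply Mx_def)
  qed
  moreover have "X m g i = \<one>\<^bsub>hatG J i\<^esub>" if "i \<in> Idx J - down m" for i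
    using that m by (auto simp: chi_apply)
  ultimately show ?thesis using assms semi_hatG by (simp add: HT_def)
qed

lemma principal_closed: "m \<in> Idx J \<Longrightarrow> g \<in> carrier (semi J m) \<Longrightarrow> principal m g \<in> carrier (MJ J)"
  unfolding principal_def by (intro cls_closed down_AI X_HT)

text \<open>Since \<open>L\<close> lies in \<open>down m\<close>, adding \<open>l\<close> does not
  change the support. The relations of \<open>down m\<close> carry \<open>l\<close> into the
  component at \<open>m\<close>, so that it acts on \<open>principal m k\<close> as translation by
  \<open>h\<close>.\<close>

lemma principal_absorb:
  assumes "m \<in> Idx J" "L \<in> AI J" "L \<subseteq> down m" "l \<in> HT L" "h \<in> carrier (hatG J m)" 
    "eqv (down m) l (X m h)" "k \<in> carrier (semi J m)" "k \<otimes>\<^bsub>hatG J m\<^esub> h \<in> carrier (semi J m)"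
  shows "principal m k \<otimes>\<^bsub>MJ J\<^esub> cls L l = principal m (k \<otimes>\<^bsub>hatG J m\<^esub> h)"
proof -
  have 1: "down m \<union> L = down m" using assms by blast
  have kl: "X m k \<otimes>\<^bsub>T\<^esub> l \<in> HT (down m)"
    using HT_mult[OF down_AI assms(2) X_HT[OF assms(1,7)] assms(4)] 1 by simp
  have "eqv (down m) (X m k \<otimes>\<^bsub>T\<^esub> l) (X m k \<otimes>\<^bsub>T\<^esub> X m h)"
    using assms semi_hatG by (intro eqv_mult[OF eqv_refl assms(6)]) simp
  then have "eqv (down m) (X m k \<otimes>\<^bsub>T\<^esub> l) (X m (k \<otimes>\<^bsub>hatG J m\<^esub> h))"
    using assms semi_hatG by (simp add: X_mult)
  then show ?thesis
    using cls_eq_iff[OF down_AI kl X_HT[OF assms(1,8)]] 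
      cls_mult[OF down_AI assms(2) X_HT[OF assms(1,7)] assms(4)] 1 by (simp add: principal_def)
qed

lemma principal_mult:
  assumes "m \<in> Idx J" "g \<in> carrier (semi J m)" "h \<in> carrier (semi J m)"
  shows "principal m g \<otimes>\<^bsub>MJ J\<^esub> principal m h = principal m (g \<otimes>\<^bsub>hatG J m\<^esub> h)"
  unfolding principal_def[of m h] using assms semi_hatG
  by (intro principal_absorb down_AI X_HT eqv_refl semi_mult_semi) auto

section \<open>Moving elements between an index and the indices below it\<close>

lemma eqv_apply:
  assumes "a \<in> AI J" "eqv a x y" "i \<in> Idx J" "i \<notin> a" shows "x i = y i"
proof -
  interpret G: comm_group "hatG J i" using hatG_group assms by simp
  have xy: "x \<in> carrier T" "y \<in> carrier T" "x \<otimes>\<^bsub>T\<^esub> inv\<^bsub>T\<^esub> y \<in> UT a" using assms by (auto simp: eqv_def)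
  have c: "x i \<in> carrier (hatG J i)" "y i \<in> carrier (hatG J i)" 
    using xy assms hatH_comp by auto
  have "(x \<otimes>\<^bsub>T\<^esub> inv\<^bsub>T\<^esub> y) i = \<one>\<^bsub>hatG J i\<^esub>" using UT_supp(2)[OF assms(1) xy(3)] assms by simp
  then have "x i \<otimes>\<^bsub>hatG J i\<^esub> inv\<^bsub>hatG J i\<^esub> y i = \<one>\<^bsub>hatG J i\<^esub>" 
    using xy assms by (simp add: hatH_mult hatH_inv)
  then show ?thesis using c G.inv_equality[of "x i" "inv\<^bsub>hatG J i\<^esub> y i"] by simp
qed

text \<open>The relations with target \<open>m\<close> are separated from the others. What they
  contribute to \<open>s - t\<close> is \<open>l - X m h\<close>, where \<open>l\<close> collects
  the elements moved to \<open>m\<close> and \<open>h\<close> is their total image; the other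
  generators belong to \<open>e - {m}\<close>. The degrees of \<open>l\<close> may be
  negative.\<close>

lemma eqv_decompose:
  assumes m: "m \<in> Idx J" and e: "eqv e s t"
  obtains l h where "l \<in> carrier T" "\<And>i. i \<in> Idx J \<Longrightarrow> i \<notin> sdown m \<Longrightarrow> l i = \<one>\<^bsub>hatG J i\<^esub>"
    "h \<in> G0 m" "eqv (down m) l (X m h)" "eqv (e - {m}) (s \<otimes>\<^bsub>T\<^esub> X m h) (t \<otimes>\<^bsub>T\<^esub> l)"
proof -
  \<comment> \<open>\<open>P v l h\<close> says that \<open>v\<close> is \<open>l - X m h\<close>
    modulo the relations with targets in \<open>e - {m}\<close>. The \<open>v\<close> that admit
    such \<open>l\<close> and \<open>h\<close> form a subgroup, so only generators need
    witnesses.\<close>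
  define P where "P v l h \<longleftrightarrow> l \<in> carrier T \<and> (\<forall>i\<in>Idx J - sdown m. l i = \<one>\<^bsub>hatG J i\<^esub>) \<and> 
    h \<in> G0 m \<and> eqv (down m) l (X m h) \<and> eqv (e - {m}) (v \<otimes>\<^bsub>T\<^esub> X m h) l" for v l h
  let ?V = "{v \<in> carrier T. \<exists>l h. P v l h}"
  interpret G: comm_group "hatG J m" using hatG_group m by simp
  have Xc: "X m h \<in> carrier T" if "h \<in> G0 m" for h using that m by (simp add: G0_iff)
  have V: "subgroup ?V T"
  proof (rule T.subgroupI)
    have "P \<one>\<^bsub>T\<^esub> \<one>\<^bsub>T\<^esub> \<one>\<^bsub>hatG J m\<^esub>"
      using m by (simp add: P_def hatH_one G0_one X_one)
    then show "?V \<noteq> {}" by blast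
  next
    fix v assume "v \<in> ?V"
    then obtain l h where v: "v \<in> carrier T" and P: "P v l h" by blast
    have Xi: "X m (inv\<^bsub>hatG J m\<^esub> h) = inv\<^bsub>T\<^esub> X m h"
    proof (rule T.inv_equality[symmetric])
      show "X m (inv\<^bsub>hatG J m\<^esub> h) \<otimes>\<^bsub>T\<^esub> X m h = \<one>\<^bsub>T\<^esub>"
        using m P by (simp add: P_def G0_iff X_one flip: X_mult)
    qed (use P m in \<open>auto simp: P_def G0_iff\<close>)
    have "eqv (e - {m}) (inv\<^bsub>T\<^esub> (v \<otimes>\<^bsub>T\<^esub> X m h)) (inv\<^bsub>T\<^esub> l)" "eqv (down m) (inv\<^bsub>T\<^esub> l) (inv\<^bsub>T\<^esub> X m h)"
      using P eqv_inv by (auto simp: P_def)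
    then have "P (inv\<^bsub>T\<^esub> v) (inv\<^bsub>T\<^esub> l) (inv\<^bsub>hatG J m\<^esub> h)"
      using P v Xc m by (auto simp: P_def T.inv_mult Xi G0_inv hatH_inv hatG_inv_one)
    then show "inv\<^bsub>T\<^esub> v \<in> ?V" using v by blast
  next
    fix v v' assume "v \<in> ?V" "v' \<in> ?V"
    then obtain l h l' h' where v: "v \<in> carrier T" "v' \<in> carrier T" and P: "P v l h" "P v' l' h'" by blast
    have Xm: "X m (h \<otimes>\<^bsub>hatG J m\<^esub> h') = X m h \<otimes>\<^bsub>T\<^esub> X m h'" 
      using P m by (simp add: P_def X_mult G0_iff)
    have c: "X m h \<in> carrier T" "X m h' \<in> carrier T" using P Xc by (auto simp: P_def)
    have "eqv (e - {m}) ((v \<otimes>\<^bsub>T\<^esub> X m h) \<otimes>\<^bsub>T\<^esub> (v' \<otimes>\<^bsub>T\<^esub> X m h')) (l \<otimes>\<^bsub>T\<^esub> l')" 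
      "eqv (down m) (l \<otimes>\<^bsub>T\<^esub> l') (X m h \<otimes>\<^bsub>T\<^esub> X m h')"
      using P by (auto simp: P_def intro: eqv_mult)
    moreover have "(v \<otimes>\<^bsub>T\<^esub> X m h) \<otimes>\<^bsub>T\<^esub> (v' \<otimes>\<^bsub>T\<^esub> X m h') = (v \<otimes>\<^bsub>T\<^esub> v') \<otimes>\<^bsub>T\<^esub> (X m h \<otimes>\<^bsub>T\<^esub> X m h')"
      using v c by (simp add: T.m_ac)
    ultimately have "P (v \<otimes>\<^bsub>T\<^esub> v') (l \<otimes>\<^bsub>T\<^esub> l') (h \<otimes>\<^bsub>hatG J m\<^esub> h')"
      using P m by (auto simp: P_def Xm G0_mult hatH_mult hatG_r_one hatG_one_closed)
    then show "v \<otimes>\<^bsub>T\<^esub> v' \<in> ?V" using v by blast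
  qed auto
  have "gens e \<subseteq> ?V"
  proof
    fix v assume "v \<in> gens e"
    then obtain i j u where v: "v = X i u \<otimes>\<^bsub>T\<^esub> inv\<^bsub>T\<^esub> (X j (hatPhi J j i u))" 
      and ij: "lt J i j" "j \<in> e" "u \<in> carrier (hatG J i)" unfolding gens_def by blast
    have I: "i \<in> Idx J" "j \<in> Idx J" using lt_Idx ij by auto
    have c: "X i u \<in> carrier T" "X j (hatPhi J j i u) \<in> carrier T" using I ij by (auto simp: hatPhi_closed)
    have "\<exists>l h. P v l h"
    proof (cases "j = m")
      \<comment> \<open>A generator with target \<open>m\<close> is itself of the form
        \<open>l - X m h\<close>, with \<open>l\<close> the element before the move and
        \<open>h\<close> its image.\<close>
      case True
      have "v \<otimes>\<^bsub>T\<^esub> X m (hatPhi J m i u) = X i u" using c True v by (simp add: T.m_assoc)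
      moreover have "m \<in> down m" using m by (simp add: down_eq)
      ultimately have "P v (X i u) (hatPhi J m i u)"
        using c ij True I by (auto simp: P_def G0_iff hatPhi_closed fst_hatPhi sdown_def chi_apply intro!: eqv_X)
      then show ?thesis by blast
    next
      case False
      have "v \<in> UT (e - {m})" unfolding UT_def v using False ij by (intro generate.incl) (unfold gens_def, blast)
      moreover have "v \<in> carrier T" using c v by simp
      ultimately have "P v \<one>\<^bsub>T\<^esub> \<one>\<^bsub>hatG J m\<^esub>"
        using m by (simp add: P_def hatH_one G0_one X_one) (simp add: eqv_def)
      then show ?thesis by blast
    qed
    then show "v \<in> ?V" using c v by simp
  qed
  then have "UT e \<subseteq> ?V" unfolding UT_def by (rule T.generate_subgroup_incl[OF _ V])
  moreover have st: "s \<in> carrier T" "t \<in> carrier T" "s \<otimes>\<^bsub>T\<^esub> inv\<^bsub>T\<^esub> t \<in> UT e" using e by (auto simp: eqv_def)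
  ultimately obtain l h where P: "P (s \<otimes>\<^bsub>T\<^esub> inv\<^bsub>T\<^esub> t) l h" by blast
  have c: "X m h \<in> carrier T" using P Xc by (auto simp: P_def)
  have "eqv (e - {m}) (t \<otimes>\<^bsub>T\<^esub> (s \<otimes>\<^bsub>T\<^esub> inv\<^bsub>T\<^esub> t \<otimes>\<^bsub>T\<^esub> X m h)) (t \<otimes>\<^bsub>T\<^esub> l)"
    using P st by (intro eqv_mult[OF eqv_refl]) (auto simp: P_def)
  moreover have "t \<otimes>\<^bsub>T\<^esub> (s \<otimes>\<^bsub>T\<^esub> inv\<^bsub>T\<^esub> t \<otimes>\<^bsub>T\<^esub> X m h) = (t \<otimes>\<^bsub>T\<^esub> inv\<^bsub>T\<^esub> t) \<otimes>\<^bsub>T\<^esub> (s \<otimes>\<^bsub>T\<^esub> X m h)"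
    using st c by (simp only: T.m_ac T.m_closed T.inv_closed)
  ultimately have "eqv (e - {m}) (s \<otimes>\<^bsub>T\<^esub> X m h) (t \<otimes>\<^bsub>T\<^esub> l)" using st c by simp
  then show ?thesis using that[of l h] P by (simp add: P_def)
qed

text \<open>Induction on a finite set containing the support: the component at one index
  \<open>i\<close> is split off and carried to \<open>m\<close> by the relation for
  \<open>i < m\<close>, whose image has degree zero.\<close>

lemma push_up:
  assumes m: "m \<in> Idx J" and l: "l \<in> carrier T" "\<And>i. i \<in> Idx J \<Longrightarrow> i \<notin> sdown m \<Longrightarrow> l i = \<one>\<^bsub>hatG J i\<^esub>"
  shows "\<exists>h\<in>G0 m. eqv (down m) l (X m h)"
proof -
  have "\<exists>h\<in>G0 m. eqv (down m) l (X m h)" 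
    if "finite S" "S \<subseteq> sdown m" "l \<in> carrier T" "\<And>i. i \<in> Idx J \<Longrightarrow> i \<notin> S \<Longrightarrow> l i = \<one>\<^bsub>hatG J i\<^esub>" for S l
    using that
  proof (induction S arbitrary: l rule: finite_induct)
    case empty
    then have "l = \<one>\<^bsub>T\<^esub>" by (intro hatH_eqI[of _ "Idx J"]) (auto simp: hatH_one)
    then show ?case using m by (intro bexI[of _ "\<one>\<^bsub>hatG J m\<^esub>"]) (auto simp: X_one G0_one)
  next
    case (insert i S)
    have im: "lt J i m" using insert.prems by (simp add: sdown_def)
    have i: "i \<in> Idx J" using lt_Idx im by blast
    have li: "l i \<in> carrier (hatG J i)" using hatH_comp insert.prems i by auto
    interpret Gi: comm_group "hatG J i" using hatG_group i by simp
    define l' where "l' = l \<otimes>\<^bsub>T\<^esub> inv\<^bsub>T\<^esub> X i (l i)"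
    have l': "l' \<in> carrier T" using insert.prems i li by (simp add: l'_def)
    have "l' k = \<one>\<^bsub>hatG J k\<^esub>" if "k \<in> Idx J" "k \<notin> S" for k
      using that insert.prems i li
      by (cases "k = i") (auto simp: l'_def hatH_mult hatH_inv chi_apply hatG_inv_one hatG_r_one hatG_one_closed)
    then obtain h where h: "h \<in> G0 m" "eqv (down m) l' (X m h)" using insert.IH[OF _ l'] insert.prems by blast
    let ?p = "hatPhi J m i (l i)"
    have "eqv (down m) (l' \<otimes>\<^bsub>T\<^esub> X i (l i)) (X m h \<otimes>\<^bsub>T\<^esub> X m ?p)"
      using im li m by (intro eqv_mult[OF h(2) eqv_X]) (auto simp: down_eq)
    moreover have "l' \<otimes>\<^bsub>T\<^esub> X i (l i) = l" using insert.prems i li by (simp add: l'_def T.m_assoc)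
    moreover have p: "?p \<in> G0 m" using im li by (simp add: G0_iff hatPhi_closed fst_hatPhi)
    ultimately have "eqv (down m) l (X m (h \<otimes>\<^bsub>hatG J m\<^esub> ?p))"
      using h m by (simp add: X_mult G0_iff)
    then show ?case using G0_mult[OF m h(1) p] by blast
  qed
  moreover have "finite (sdown m)" using AI_subset[OF sdown_AI] fin finite_subset by blast
  ultimately show ?thesis using l by blast
qed

text \<open>At each free index of \<open>a\<close>, \<open>p\<close> gets the degree
  \<open>|fst (l i)| + 1\<close>. The absolute value outweighs a negative degree of
  \<open>l\<close>, and the extra 1 makes the degrees of both \<open>p\<close> and
  \<open>l + p\<close> at least 1. Both are then admissible no matter which indices of
  \<open>a\<close> are maximal.\<close>

lemma make_positive:
  assumes l: "l \<in> carrier T" "\<And>i. i \<in> Idx J \<Longrightarrow> i \<notin> a \<Longrightarrow> l i = \<one>\<^bsub>hatG J i\<^esub>"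
  obtains p where "p \<in> HT a" "l \<otimes>\<^bsub>T\<^esub> p \<in> HT a" "\<forall>i\<in>a \<inter> Free J. fst (p i) \<ge> 1"
proof -
  define p where "p = (\<lambda>i\<in>Idx J. if i \<in> a \<and> i \<in> Free J then (\<bar>fst (l i)\<bar> + 1, \<one>\<^bsub>Grp J i\<^esub>) else \<one>\<^bsub>hatG J i\<^esub>)"
  have "p i \<in> carrier (hatG J i)" if "i \<in> Idx J" for i
    using that hatG_one_closed[of i] by (auto simp: p_def carrier_hatG one_hatG)
  then have p: "p \<in> carrier T" by (auto simp: hatH_carrier p_def)
  have "fst ((l \<otimes>\<^bsub>T\<^esub> p) i) \<ge> 1" if "i \<in> a" "i \<in> Free J" for i
  proof -
    have i: "i \<in> Idx J" using that Free_subset by blast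
    then have "fst ((l \<otimes>\<^bsub>T\<^esub> p) i) = fst (l i) + fst (p i)"
      using l p by (simp add: hatH_mult fst_mult_hatG hatH_comp)
    then show ?thesis using that i by (simp add: p_def)
  qed
  then have "l \<otimes>\<^bsub>T\<^esub> p \<in> HT a"
    using l p by (intro HT_I) (auto simp: hatH_mult p_def hatG_r_one hatG_one_closed)
  moreover have pos: "fst (p i) \<ge> 1" if "i \<in> a" "i \<in> Free J" for i
    using that Free_subset by (auto simp: p_def)
  moreover have "p \<in> HT a" by (rule HT_I[OF p _ pos]) (auto simp: p_def)
  ultimately show ?thesis using that by blast
qed

section \<open>Refinement\<close>

lemma fst_cls [simp]: "fst (cls a x) = a"
  by (simp add: cls_def)

lemma fst_MJ: "A \<in> carrier (MJ J) \<Longrightarrow> fst A \<in> AI J"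
  by (auto simp: MJ_carrier)

lemma fst_mult:
  assumes "A \<in> carrier (MJ J)" "B \<in> carrier (MJ J)" shows "fst (A \<otimes>\<^bsub>MJ J\<^esub> B) = fst A \<union> fst B"
proof -
  obtain a x where a: "A = cls a x" "a \<in> AI J" "x \<in> HT a" by (rule MJ_obtain[OF assms(1)])
  obtain b y where b: "B = cls b y" "b \<in> AI J" "y \<in> HT b" by (rule MJ_obtain[OF assms(2)])
  show ?thesis using a b by (simp add: cls_mult)
qed

text \<open>Deleting the component at \<open>m\<close> is not enough: indices below \<open>m\<close>
  may become maximal in \<open>a - {m}\<close>, where free ones need positive degree. So an element
  \<open>p\<close> of positive degrees below \<open>m\<close> is added to the rest, and its image
  \<open>h\<close> is subtracted at \<open>m\<close>.\<close>

lemma split_max: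
  assumes A: "A \<in> carrier (MJ J)" and m: "m \<in> Mx J (fst A)"
  obtains A0 g where "A0 \<in> carrier (MJ J)" "g \<in> carrier (semi J m)" "fst A0 = fst A - {m}"
    "A = A0 \<otimes>\<^bsub>MJ J\<^esub> principal m g"
proof -
  obtain a x where a: "A = cls a x" "a \<in> AI J" "x \<in> HT a" by (rule MJ_obtain[OF A])
  have ma: "m \<in> Mx J a" "m \<in> a" using m a by (auto simp: Mx_def)
  have mI: "m \<in> Idx J" using AI_subset[OF a(2)] ma by blast
  have sd: "sdown m \<subseteq> a - {m}" using sdown_subset[OF a(2) ma(2)] sdown_irrefl by blast
  interpret G: comm_group "hatG J m" using hatG_group mI by simp
  have one: "\<one>\<^bsub>T\<^esub> i = \<one>\<^bsub>hatG J i\<^esub>" if "i \<in> Idx J" "i \<notin> sdown m" for i using that by (simp add: hatH_one)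
  \<comment> \<open>Here \<open>l\<close> is the neutral element, since only a \<open>p\<close> with
    positive degrees is wanted.\<close>
  obtain p where p: "p \<in> HT (sdown m)" "\<one>\<^bsub>T\<^esub> \<otimes>\<^bsub>T\<^esub> p \<in> HT (sdown m)" 
    "\<forall>i\<in>sdown m \<inter> Free J. fst (p i) \<ge> 1"
    by (rule make_positive[OF T.one_closed one])
  have pc: "p \<in> carrier T" using HT_closed[OF p(1)] .
  obtain h where h: "h \<in> G0 m" "eqv (down m) p (X m h)"
    using push_up[OF mI pc HT_off[OF p(1)]] by blast
  have hc: "h \<in> carrier (hatG J m)" using h by (simp add: G0_iff)
  have xc: "x \<in> carrier T" using HT_closed[OF a(3)] .
  have xm: "x m \<in> carrier (hatG J m)" using hatH_comp xc mI by auto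
  have "x m \<in> carrier (semi J m)" 
    using a(3) ma xm by (auto simp: semi_iff HT_def)
  define g where "g = x m \<otimes>\<^bsub>hatG J m\<^esub> inv\<^bsub>hatG J m\<^esub> h"
  have g: "g \<in> carrier (semi J m)" 
    using semi_mult_G0[OF mI \<open>x m \<in> carrier (semi J m)\<close> G0_inv[OF mI h(1)]] by (simp add: g_def)
  have gh: "g \<otimes>\<^bsub>hatG J m\<^esub> h = x m" using hc xm by (simp add: g_def G.m_assoc)
  define x0 where "x0 = (x \<otimes>\<^bsub>T\<^esub> inv\<^bsub>T\<^esub> X m (x m)) \<otimes>\<^bsub>T\<^esub> p"
  have x0c: "x0 \<in> carrier T" using xc xm mI pc by (simp add: x0_def)
  have x0_i: "x0 i = x i \<otimes>\<^bsub>hatG J i\<^esub> p i" if i: "i \<in> Idx J" "i \<noteq> m" for i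
    using i xm mI hatH_comp[OF xc, of i] by (simp add: x0_def hatH_mult hatH_inv chi_apply hatG_inv_one hatG_r_one)
  have x0_m: "x0 m = \<one>\<^bsub>hatG J m\<^esub>"
    using xm mI sdown_irrefl HT_off[OF p(1), of m] by (simp add: x0_def hatH_mult hatH_inv chi_apply)
  have x0: "x0 \<in> HT (a - {m})"
  proof -
    have "x0 i = \<one>\<^bsub>hatG J i\<^esub>" if "i \<in> Idx J - (a - {m})" for i
    proof (cases "i = m")
      case False
      then have "i \<notin> a" "i \<notin> sdown m" using that sd by auto
      then show ?thesis
        using that False x0_i[of i] HT_off[OF a(3), of i] HT_off[OF p(1), of i]
        by (simp add: hatG_r_one hatG_one_closed)
    qed (simp add: x0_m)
    moreover have "x0 i = \<one>\<^bsub>hatG J i\<^esub> \<and> i \<notin> Mx J (a - {m}) \<or> fst (x0 i) \<ge> 1" 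
      if i: "i \<in> (a - {m}) \<inter> Free J" for i
    proof -
      have iI: "i \<in> Idx J" using i Free_subset by blast
      have x: "x i = \<one>\<^bsub>hatG J i\<^esub> \<and> i \<notin> Mx J a \<or> fst (x i) \<ge> 1" using a(3) i by (auto simp: HT_def)
      show ?thesis
      proof (cases "i \<in> sdown m")
        case True
        have "fst (x0 i) = fst (x i) + fst (p i)"
          using x0_i iI i hatH_comp[OF xc iI] hatH_comp[OF pc iI] by (simp add: fst_mult_hatG)
        moreover have "fst (x i) \<ge> 0" using x by (auto simp: one_hatG)
        moreover have "fst (p i) \<ge> 1" using p(3) True i by blast
        ultimately show ?thesis by simp
      next
        case False
        then have "x0 i = x i" 
          using x0_i[OF iI] i HT_off[OF p(1) iI] hatH_comp[OF xc iI] iI by (simp add: hatG_r_one)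
        \<comment> \<open>Only \<open>m\<close> has been removed, so an index not below
          \<open>m\<close> that is maximal afterwards was maximal before.\<close>
        moreover have "i \<in> Mx J a" if "i \<in> Mx J (a - {m})"
          using that False by (auto simp: Mx_def sdown_def)
        ultimately show ?thesis using x by auto
      qed
    qed
    ultimately show ?thesis using x0c by (simp add: HT_def)
  qed
  have am: "a - {m} \<in> AI J" using AI_remove a ma by blast
  have un: "(a - {m}) \<union> down m = a" using sd ma mI by (auto simp: down_eq)
  have Xg: "X m g \<in> carrier T" using semi_hatG[OF g] mI by simp
  have Xh: "X m h \<in> carrier T" using hc mI by simp
  have "eqv a (x0 \<otimes>\<^bsub>T\<^esub> X m g) x"
  \<comment> \<open>Both sides are compared after adding \<open>X m h\<close>: this restores
    \<open>x m\<close> on the left, and the remaining surplus \<open>p\<close> is congruent to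
    \<open>X m h\<close>.\<close>
  proof (rule eqv_cancel[OF _ _ xc Xh])
    have "(x0 \<otimes>\<^bsub>T\<^esub> X m g) \<otimes>\<^bsub>T\<^esub> X m h = x0 \<otimes>\<^bsub>T\<^esub> X m (x m)"
      using x0c Xg Xh gh mI hc semi_hatG[OF g] by (simp add: T.m_assoc flip: X_mult)
    also have "\<dots> = (x \<otimes>\<^bsub>T\<^esub> p) \<otimes>\<^bsub>T\<^esub> (inv\<^bsub>T\<^esub> X m (x m) \<otimes>\<^bsub>T\<^esub> X m (x m))"
      using xc pc mI xm unfolding x0_def by (simp only: T.m_ac T.m_closed T.inv_closed X_closed)
    also have "\<dots> = x \<otimes>\<^bsub>T\<^esub> p" using xc pc mI xm by simp
    finally have 1: "(x0 \<otimes>\<^bsub>T\<^esub> X m g) \<otimes>\<^bsub>T\<^esub> X m h = x \<otimes>\<^bsub>T\<^esub> p" .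
    show "eqv a ((x0 \<otimes>\<^bsub>T\<^esub> X m g) \<otimes>\<^bsub>T\<^esub> X m h) (x \<otimes>\<^bsub>T\<^esub> X m h)" unfolding 1
      using un by (intro eqv_mult[OF eqv_refl[OF xc] eqv_mono[OF h(2)]]) auto
  qed (use x0c Xg in auto)
  then have "cls a (x0 \<otimes>\<^bsub>T\<^esub> X m g) = cls a x"
    using cls_eq_iff[OF a(2) _ a(3)] HT_mult[OF am down_AI x0 X_HT[OF mI g]] un by simp
  then have dec: "A = cls (a - {m}) x0 \<otimes>\<^bsub>MJ J\<^esub> principal m g"
    using cls_mult[OF am down_AI x0 X_HT[OF mI g]] un a by (simp add: principal_def)
  have "fst (cls (a - {m}) x0) = fst A - {m}" using a by simp
  from that[OF cls_closed[OF am x0] g this dec] show ?thesis .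
qed

text \<open>\<open>eqv_decompose\<close> gives an exact equation at \<open>m\<close> and an equation
  off \<open>m\<close> with a correction \<open>l\<close> below \<open>m\<close>. As
  \<open>l\<close> may have negative degrees, it is not itself an element of the monoid; adding a
  positive \<open>p\<close> to both sides replaces it by the pair \<open>Z\<close>,
  \<open>Z'\<close> represented by \<open>p\<close> and \<open>l + p\<close>. The last two
  conclusions say that at \<open>m\<close> these act as translations by \<open>h\<close> and
  \<open>h'\<close>.\<close>

lemma cancel_max:
  assumes Y: "Y \<in> carrier (MJ J)" "Y' \<in> carrier (MJ J)" and m: "m \<in> Idx J" "m \<notin> fst Y" "m \<notin> fst Y'" 
    and g: "g \<in> carrier (semi J m)" "g' \<in> carrier (semi J m)"
    and eq: "Y \<otimes>\<^bsub>MJ J\<^esub> principal m g = Y' \<otimes>\<^bsub>MJ J\<^esub> principal m g'"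
  obtains Z Z' h h' where "Z \<in> carrier (MJ J)" "Z' \<in> carrier (MJ J)" "fst Z = sdown m" "fst Z' = sdown m"
    "h \<in> G0 m" "h' \<in> G0 m" "Y \<otimes>\<^bsub>MJ J\<^esub> Z = Y' \<otimes>\<^bsub>MJ J\<^esub> Z'" 
    "g \<otimes>\<^bsub>hatG J m\<^esub> h' = g' \<otimes>\<^bsub>hatG J m\<^esub> h"
    "\<And>k. k \<in> carrier (semi J m) \<Longrightarrow> principal m k \<otimes>\<^bsub>MJ J\<^esub> Z = principal m (k \<otimes>\<^bsub>hatG J m\<^esub> h)"
    "\<And>k. k \<in> carrier (semi J m) \<Longrightarrow> principal m k \<otimes>\<^bsub>MJ J\<^esub> Z' = principal m (k \<otimes>\<^bsub>hatG J m\<^esub> h')"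
proof -
  obtain a y where a: "Y = cls a y" "a \<in> AI J" "y \<in> HT a" by (rule MJ_obtain[OF Y(1)])
  obtain c y' where c: "Y' = cls c y'" "c \<in> AI J" "y' \<in> HT c" by (rule MJ_obtain[OF Y(2)])
  interpret G: comm_group "hatG J m" using hatG_group m by simp
  have yc: "y \<in> carrier T" "y' \<in> carrier T" using a c HT_closed by blast+
  have gc: "g \<in> carrier (hatG J m)" "g' \<in> carrier (hatG J m)" using g semi_hatG by auto
  have Xg: "X m g \<in> carrier T" "X m g' \<in> carrier T" using gc m by auto
  have ac: "a \<union> down m = c \<union> down m" and e: "eqv (a \<union> down m) (y \<otimes>\<^bsub>T\<^esub> X m g) (y' \<otimes>\<^bsub>T\<^esub> X m g')"
    using eq a c cls_mult[OF a(2) down_AI a(3) X_HT[OF m(1) g(1)]] cls_mult[OF c(2) down_AI c(3) X_HT[OF m(1) g(2)]]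
      cls_eq_iff[OF AI_Un[OF a(2) down_AI] HT_mult[OF a(2) down_AI a(3) X_HT[OF m(1) g(1)]] 
        HT_mult[OF c(2) down_AI c(3) X_HT[OF m(1) g(2)]]] by (auto simp: principal_def)
  obtain l h where l: "l \<in> carrier T" "\<And>i. i \<in> Idx J \<Longrightarrow> i \<notin> sdown m \<Longrightarrow> l i = \<one>\<^bsub>hatG J i\<^esub>"
    and h: "h \<in> G0 m" "eqv (down m) l (X m h)" 
    and e': "eqv (a \<union> down m - {m}) ((y \<otimes>\<^bsub>T\<^esub> X m g) \<otimes>\<^bsub>T\<^esub> X m h) ((y' \<otimes>\<^bsub>T\<^esub> X m g') \<otimes>\<^bsub>T\<^esub> l)"
    by (rule eqv_decompose[OF m(1) e]) blast
  have mac: "m \<notin> a" "m \<notin> c" using m a c by auto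
  have s: "a \<union> down m - {m} = a \<union> sdown m" "a \<union> down m - {m} = c \<union> sdown m"
  proof -
    have "insert m (a \<union> sdown m) = insert m (c \<union> sdown m)" using ac m by (simp add: down_eq)
    then have "a \<union> sdown m = c \<union> sdown m"
      using mac sdown_irrefl[of m] by (subst (asm) insert_ident) auto
    moreover show "a \<union> down m - {m} = a \<union> sdown m"
      using mac m sdown_irrefl[of m] by (auto simp: down_eq)
    ultimately show "a \<union> down m - {m} = c \<union> sdown m" by simp
  qed
  have sA: "a \<union> sdown m \<in> AI J" "m \<notin> a \<union> sdown m" using AI_Un a sdown_AI mac sdown_irrefl by auto
  have hc: "h \<in> carrier (hatG J m)" using h by (simp add: G0_iff)
  have Xh: "X m h \<in> carrier T" using hc m by simp
  \<comment> \<open>The remaining relations have targets in \<open>a \<union> sdown m\<close> and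
    cannot change the component at \<open>m\<close>, where the congruence is therefore an
    equality.\<close>
  have gh: "g \<otimes>\<^bsub>hatG J m\<^esub> h = g'"
    using eqv_apply[OF sA(1) e'[unfolded s(1)] m(1) sA(2)] m gc hc HT_off[OF a(3) m(1) mac(1)] 
      HT_off[OF c(3) m(1) mac(2)] l(2)[OF m(1) sdown_irrefl] by (simp add: hatH_mult chi_apply)
  have "(y \<otimes>\<^bsub>T\<^esub> X m g) \<otimes>\<^bsub>T\<^esub> X m h = y \<otimes>\<^bsub>T\<^esub> X m g'"
    using yc Xg Xh gh m gc hc by (simp add: T.m_assoc flip: X_mult)
  moreover have "(y' \<otimes>\<^bsub>T\<^esub> X m g') \<otimes>\<^bsub>T\<^esub> l = (y' \<otimes>\<^bsub>T\<^esub> l) \<otimes>\<^bsub>T\<^esub> X m g'"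
    using yc Xg l by (simp add: T.m_ac)
  ultimately have "eqv (a \<union> sdown m) (y \<otimes>\<^bsub>T\<^esub> X m g') ((y' \<otimes>\<^bsub>T\<^esub> l) \<otimes>\<^bsub>T\<^esub> X m g')"
    using e' s by simp
  then have el: "eqv (a \<union> sdown m) y (y' \<otimes>\<^bsub>T\<^esub> l)" by (rule eqv_cancel) (use yc l Xg in auto)
  obtain p where p: "p \<in> HT (sdown m)" "l \<otimes>\<^bsub>T\<^esub> p \<in> HT (sdown m)"
    by (rule make_positive[OF l])
  have pc: "p \<in> carrier T" using HT_closed[OF p(1)] .
  obtain q where q: "q \<in> G0 m" "eqv (down m) p (X m q)"
    using push_up[OF m(1) pc HT_off[OF p(1)]] by blast
  have qc: "q \<in> carrier (hatG J m)" using q by (simp add: G0_iff)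
  have lp: "eqv (down m) (l \<otimes>\<^bsub>T\<^esub> p) (X m (h \<otimes>\<^bsub>hatG J m\<^esub> q))"
    using eqv_mult[OF h(2) q(2)] m hc qc by (simp add: X_mult)
  have sub: "sdown m \<subseteq> down m" using m by (auto simp: down_eq)
  show ?thesis
  \<comment> \<open>The \<open>h\<close> of the conclusion is \<open>q\<close>, the image of
    \<open>p\<close>; its \<open>h'\<close> is the image of \<open>l + p\<close>, which is the local
    \<open>h\<close> plus \<open>q\<close>.\<close>
  proof (rule that[of "cls (sdown m) p" "cls (sdown m) (l \<otimes>\<^bsub>T\<^esub> p)" q "h \<otimes>\<^bsub>hatG J m\<^esub> q"])
    show "cls (sdown m) p \<in> carrier (MJ J)" "cls (sdown m) (l \<otimes>\<^bsub>T\<^esub> p) \<in> carrier (MJ J)"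
      using cls_closed[OF sdown_AI] p by auto
    have "eqv (a \<union> sdown m) (y \<otimes>\<^bsub>T\<^esub> p) ((y' \<otimes>\<^bsub>T\<^esub> l) \<otimes>\<^bsub>T\<^esub> p)"
      by (rule eqv_mult[OF el eqv_refl[OF pc]])
    then have "eqv (a \<union> sdown m) (y \<otimes>\<^bsub>T\<^esub> p) (y' \<otimes>\<^bsub>T\<^esub> (l \<otimes>\<^bsub>T\<^esub> p))"
      using yc l pc by (simp add: T.m_assoc)
    then show "Y \<otimes>\<^bsub>MJ J\<^esub> cls (sdown m) p = Y' \<otimes>\<^bsub>MJ J\<^esub> cls (sdown m) (l \<otimes>\<^bsub>T\<^esub> p)"
      using cls_mult[OF a(2) sdown_AI a(3) p(1)] cls_mult[OF c(2) sdown_AI c(3) p(2)] s a(1) c(1)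
       cls_eq_iff[OF sA(1) HT_mult[OF a(2) sdown_AI a(3) p(1)] HT_mult[OF c(2) sdown_AI c(3) p(2)]] by simp
    show "g \<otimes>\<^bsub>hatG J m\<^esub> (h \<otimes>\<^bsub>hatG J m\<^esub> q) = g' \<otimes>\<^bsub>hatG J m\<^esub> q"
      using gc hc qc gh by (simp flip: G.m_assoc)
    show "h \<otimes>\<^bsub>hatG J m\<^esub> q \<in> G0 m" using G0_mult m h q by blast
    then show "principal m k \<otimes>\<^bsub>MJ J\<^esub> cls (sdown m) (l \<otimes>\<^bsub>T\<^esub> p) = principal m (k \<otimes>\<^bsub>hatG J m\<^esub> (h \<otimes>\<^bsub>hatG J m\<^esub> q))"
      if "k \<in> carrier (semi J m)" for k
      using principal_absorb[OF m(1) sdown_AI sub p(2) _ lp that semi_mult_G0[OF m(1) that]] by (simp add: G0_iff)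
    show "principal m k \<otimes>\<^bsub>MJ J\<^esub> cls (sdown m) p = principal m (k \<otimes>\<^bsub>hatG J m\<^esub> q)"
      if "k \<in> carrier (semi J m)" for k
      using principal_absorb[OF m(1) sdown_AI sub p(1) qc q(2) that semi_mult_G0[OF m(1) that q(1)]] .
  qed (simp_all add: q)
qed

lemma Free_absorb:
  assumes m: "m \<in> Free J" and d: "d \<in> G0 m"
  shows "\<exists>Y\<in>carrier (MJ J). \<forall>k\<in>carrier (semi J m). principal m k \<otimes>\<^bsub>MJ J\<^esub> Y = principal m (k \<otimes>\<^bsub>hatG J m\<^esub> d)"
proof -
  have mI: "m \<in> Idx J" using m Free_subset by blast
  interpret G: comm_group "hatG J m" using hatG_group mI by simp
  interpret K: comm_group "Grp J m" using comm_group_Grp mI by simp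
  obtain \<gamma> where \<gamma>: "d = (0, \<gamma>)" "\<gamma> \<in> carrier (Grp J m)" using d by (auto simp: G0_def)
  obtain n :: nat and k x where kx: "\<And>l. l < n \<Longrightarrow> lt J (k l) m \<and> x l \<in> carrier (semi J (k l))"
    "\<gamma> = (\<Otimes>\<^bsub>Grp J m\<^esub>l\<in>{..<n}. Phi J m (k l) (x l))" by (rule Free_generated[OF m \<gamma>(2)]) blast
  define f where "f l = Phi J m (k l) (x l)" for l
  \<comment> \<open>Condition (c2) speaks of the given maps \<open>Phi\<close>, the relations of
    \<open>hatPhi\<close>; on the semigroups the two agree.\<close>
  have hf: "hatPhi J m (k l) (x l) = (0, f l)" if "l < n" for l
    using kx(1)[OF that] extPhi_hom(2) by (simp add: hatPhi_def lt_def f_def)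
  have f0: "(0, f l) \<in> G0 m" if "l < n" for l
    using kx(1)[OF that] hatPhi_closed[of "k l" m "x l"] fst_hatPhi semi_hatG hf[OF that] by (simp add: G0_iff)
  then have fc: "f l \<in> carrier (Grp J m)" if "l < n" for l using that by (auto simp: G0_def)
  have "\<exists>Y\<in>carrier (MJ J). \<forall>k\<in>carrier (semi J m). principal m k \<otimes>\<^bsub>MJ J\<^esub> Y = 
      principal m (k \<otimes>\<^bsub>hatG J m\<^esub> (0, \<Otimes>\<^bsub>Grp J m\<^esub>l\<in>{..<p}. f l))" if "p \<le> n" for p
    using that
  proof (induction p)
    case 0
    have "principal m k \<otimes>\<^bsub>MJ J\<^esub> \<one>\<^bsub>MJ J\<^esub> = principal m (k \<otimes>\<^bsub>hatG J m\<^esub> \<one>\<^bsub>hatG J m\<^esub>)" if "k \<in> carrier (semi J m)" for k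
      using that mI semi_hatG by (simp add: principal_closed)
    then show ?case by (intro bexI[of _ "\<one>\<^bsub>MJ J\<^esub>"]) (auto simp: one_hatG)
  next
    case (Suc p)
    then have p: "p < n" by simp
    let ?F = "\<Otimes>\<^bsub>Grp J m\<^esub>l\<in>{..<p}. f l"
    obtain Y where Y: "Y \<in> carrier (MJ J)" 
      "\<And>k. k\<in>carrier (semi J m) \<Longrightarrow> principal m k \<otimes>\<^bsub>MJ J\<^esub> Y = principal m (k \<otimes>\<^bsub>hatG J m\<^esub> (0, ?F))"
      using Suc by auto
    have F: "?F \<in> carrier (Grp J m)" using fc Suc.prems by (intro K.finprod_closed) auto
    then have F0: "(0, ?F) \<in> G0 m" by (simp add: G0_def)
    have "(\<Otimes>\<^bsub>Grp J m\<^esub>l\<in>{..<Suc p}. f l) = f p \<otimes>\<^bsub>Grp J m\<^esub> ?F"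
      unfolding lessThan_Suc using fc Suc.prems by (intro K.finprod_insert) auto
    then have S: "(0, \<Otimes>\<^bsub>Grp J m\<^esub>l\<in>{..<Suc p}. f l) = (0, ?F) \<otimes>\<^bsub>hatG J m\<^esub> (0, f p)"
      using F0 f0[OF p] fc[OF p] F by (simp add: mult_hatG G0_iff K.m_comm)
    have kp: "lt J (k p) m" "x p \<in> carrier (semi J (k p))" using kx(1)[OF p] by auto
    have kI: "k p \<in> Idx J" using lt_Idx(1)[OF kp(1)] .
    have sub: "down (k p) \<subseteq> down m" using kp Le_trans by (auto simp: down_def lt_def)
    have ev: "eqv (down m) (X (k p) (x p)) (X m (0, f p))"
      using eqv_X[OF kp(1) _ semi_hatG[OF kp(2)], of "down m"] hf[OF p] mI by (simp add: down_eq)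
    have fp: "(0, f p) \<in> carrier (hatG J m)" using f0[OF p] by (simp add: G0_iff)
    show ?case
    \<comment> \<open>The principal element of the next summand is added to the element that absorbs
      the first \<open>p\<close> summands.\<close>
    proof (intro bexI[of _ "Y \<otimes>\<^bsub>MJ J\<^esub> principal (k p) (x p)"] ballI)
      have E: "principal (k p) (x p) \<in> carrier (MJ J)" using principal_closed[OF kI kp(2)] .
      show "Y \<otimes>\<^bsub>MJ J\<^esub> principal (k p) (x p) \<in> carrier (MJ J)" using Y E by simp
      fix g assume g: "g \<in> carrier (semi J m)"
      have gF: "g \<otimes>\<^bsub>hatG J m\<^esub> (0, ?F) \<in> carrier (semi J m)" using semi_mult_G0 mI g F0 by blast
      have "principal m g \<otimes>\<^bsub>MJ J\<^esub> (Y \<otimes>\<^bsub>MJ J\<^esub> principal (k p) (x p)) = principal m (g \<otimes>\<^bsub>hatG J m\<^esub> (0, ?F)) \<otimes>\<^bsub>MJ J\<^esub> principal (k p) (x p)"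
        using Y E g principal_closed[OF mI g] by (simp flip: M.m_assoc)
      also have "\<dots> = principal m ((g \<otimes>\<^bsub>hatG J m\<^esub> (0, ?F)) \<otimes>\<^bsub>hatG J m\<^esub> (0, f p))"
        unfolding principal_def[of "k p"]
        by (rule principal_absorb[OF mI down_AI sub X_HT[OF kI kp(2)] fp ev gF semi_mult_G0[OF mI gF f0[OF p]]])
      also have "(g \<otimes>\<^bsub>hatG J m\<^esub> (0, ?F)) \<otimes>\<^bsub>hatG J m\<^esub> (0, f p) = g \<otimes>\<^bsub>hatG J m\<^esub> ((0, ?F) \<otimes>\<^bsub>hatG J m\<^esub> (0, f p))"
        using semi_hatG[OF g] F0 fp by (simp add: G.m_assoc G0_iff)
      finally show "principal m g \<otimes>\<^bsub>MJ J\<^esub> (Y \<otimes>\<^bsub>MJ J\<^esub> principal (k p) (x p)) = 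
        principal m (g \<otimes>\<^bsub>hatG J m\<^esub> (0, \<Otimes>\<^bsub>Grp J m\<^esub>l\<in>{..<Suc p}. f l))" using S by simp
    qed
  qed
  from this[of n] show ?thesis using \<gamma> kx(2) by (simp add: f_def)
qed

section \<open>Refinement of the components at a single index\<close>

lemma absorb_nonneg:
  assumes mI: "m \<in> Idx J" and d: "d \<in> carrier (hatG J m)" "m \<in> Free J \<longrightarrow> fst d \<ge> 0"
  shows "\<exists>Y\<in>carrier (MJ J). \<forall>k\<in>carrier (semi J m). principal m k \<otimes>\<^bsub>MJ J\<^esub> Y = principal m (k \<otimes>\<^bsub>hatG J m\<^esub> d)"
proof (cases "d \<in> carrier (semi J m)")
  case True
  then show ?thesis using principal_closed principal_mult mI by blast
next
  case False
  then have "m \<in> Free J" "fst d = 0" using d by (auto simp: semi_iff)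
  then show ?thesis using Free_absorb d by (simp add: G0_iff)
qed

definition opt_principal :: "'i \<Rightarrow> 'i set \<times> ('i \<Rightarrow> int \<times> 'g) set \<Rightarrow> int \<times> 'g \<Rightarrow> bool" where
  "opt_principal m B g \<longleftrightarrow> B = \<one>\<^bsub>MJ J\<^esub> \<and> g = \<one>\<^bsub>hatG J m\<^esub> \<or> g \<in> carrier (semi J m) \<and> B = principal m g"

text \<open>The matrix has rows \<open>gA, 0\<close> and \<open>Y, gD\<close>, with \<open>Y\<close>
  acting as translation by \<open>d = gC - gA = gB - gD\<close>. The degree hypothesis makes the
  degree of \<open>d\<close> nonnegative, which is what the existence of \<open>Y\<close>
  requires.\<close>

lemma local_refinement_le:
  assumes mI: "m \<in> Idx J" and g: "gA \<in> carrier (semi J m)" "gB \<in> carrier (semi J m)" "gC \<in> carrier (semi J m)" 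
    "gD \<in> carrier (semi J m)" and eq: "gA \<otimes>\<^bsub>hatG J m\<^esub> gB = gC \<otimes>\<^bsub>hatG J m\<^esub> gD" 
    and le: "fst gA \<le> fst gC"
  shows "refines (MJ J) (principal m gA) (principal m gB) (principal m gC) (principal m gD)"
proof -
  interpret G: comm_group "hatG J m" using hatG_group mI by simp
  note c = g[THEN semi_hatG]
  define d where "d = gC \<otimes>\<^bsub>hatG J m\<^esub> inv\<^bsub>hatG J m\<^esub> gA"
  have d: "d \<in> carrier (hatG J m)" using c by (simp add: d_def)
  have "fst d \<ge> 0" using c le mI by (simp add: d_def fst_mult_hatG fst_inv_hatG)
  then obtain Y where Y: "Y \<in> carrier (MJ J)" 
    "\<And>k. k \<in> carrier (semi J m) \<Longrightarrow> principal m k \<otimes>\<^bsub>MJ J\<^esub> Y = principal m (k \<otimes>\<^bsub>hatG J m\<^esub> d)"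
    using absorb_nonneg[OF mI d] by blast
  have AC: "gA \<otimes>\<^bsub>hatG J m\<^esub> d = gC" using c by (simp add: d_def G.m_lcomm[of gA gC])
  have "gA \<otimes>\<^bsub>hatG J m\<^esub> (gD \<otimes>\<^bsub>hatG J m\<^esub> d) = (gA \<otimes>\<^bsub>hatG J m\<^esub> d) \<otimes>\<^bsub>hatG J m\<^esub> gD"
    using c d by (simp add: G.m_ac)
  then have "gA \<otimes>\<^bsub>hatG J m\<^esub> (gD \<otimes>\<^bsub>hatG J m\<^esub> d) = gA \<otimes>\<^bsub>hatG J m\<^esub> gB" using AC eq by simp
  then have DB: "gD \<otimes>\<^bsub>hatG J m\<^esub> d = gB" using c d by simp
  show ?thesis
    by (rule refinesI[of "principal m gA" _ "\<one>\<^bsub>MJ J\<^esub>" Y "principal m gD"])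
       (use g mI Y AC DB principal_closed in \<open>simp_all add: M.m_comm\<close>)
qed

text \<open>If \<open>B\<close> or \<open>D\<close> has no component at \<open>m\<close>, the
  equation in the group already yields a matrix with neutral entries. If all four components are
  present, \<open>gA\<close> and \<open>gC\<close> are compared by degree, and transposition handles
  the reverse order.\<close>

lemma local_refinement:
  assumes mI: "m \<in> Idx J" and g: "gA \<in> carrier (semi J m)" "gC \<in> carrier (semi J m)" 
    and B: "opt_principal m B gB" and D: "opt_principal m D gD" and eq: "gA \<otimes>\<^bsub>hatG J m\<^esub> gB = gC \<otimes>\<^bsub>hatG J m\<^esub> gD" 
  shows "refines (MJ J) (principal m gA) B (principal m gC) D"
proof -
  interpret G: comm_group "hatG J m" using hatG_group mI by simp
  note c = g[THEN semi_hatG]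
  consider "B = \<one>\<^bsub>MJ J\<^esub>" "gB = \<one>\<^bsub>hatG J m\<^esub>" "D = \<one>\<^bsub>MJ J\<^esub>" "gD = \<one>\<^bsub>hatG J m\<^esub>"
    | "B = \<one>\<^bsub>MJ J\<^esub>" "gB = \<one>\<^bsub>hatG J m\<^esub>" "gD \<in> carrier (semi J m)" "D = principal m gD"
    | "gB \<in> carrier (semi J m)" "B = principal m gB" "D = \<one>\<^bsub>MJ J\<^esub>" "gD = \<one>\<^bsub>hatG J m\<^esub>"
    | "gB \<in> carrier (semi J m)" "B = principal m gB" "gD \<in> carrier (semi J m)" "D = principal m gD"
    using B D by (auto simp: opt_principal_def)
  then show ?thesis
  proof cases
    case 1
    then have "gA = gC" using eq c by simp
    then show ?thesis using 1 principal_closed[OF mI g(1)]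
      by (intro refinesI[of "principal m gA" _ "\<one>\<^bsub>MJ J\<^esub>" "\<one>\<^bsub>MJ J\<^esub>" "\<one>\<^bsub>MJ J\<^esub>"]) auto
  next
    case 2
    then have "principal m gA = principal m gC \<otimes>\<^bsub>MJ J\<^esub> principal m gD" using eq c g mI by (simp add: principal_mult)
    then show ?thesis using 2 principal_closed[OF mI] g
      by (intro refinesI[of "principal m gC" _ "principal m gD" "\<one>\<^bsub>MJ J\<^esub>" "\<one>\<^bsub>MJ J\<^esub>"]) auto
  next
    case 3
    then have "principal m gC = principal m gA \<otimes>\<^bsub>MJ J\<^esub> principal m gB" using eq c g mI by (simp add: principal_mult)
    then show ?thesis using 3 principal_closed[OF mI] g
      by (intro refinesI[of "principal m gA" _ "\<one>\<^bsub>MJ J\<^esub>" "principal m gB" "\<one>\<^bsub>MJ J\<^esub>"]) auto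
  next
    case 4
    show ?thesis
    proof (cases "fst gA \<le> fst gC")
      case True
      then show ?thesis using local_refinement_le[OF mI g(1) 4(1) g(2) 4(3) eq] 4 by simp
    next
      case False
      then show ?thesis using local_refinement_le[OF mI g(2) 4(3) g(1) 4(1) eq[symmetric]] 4 
        by (simp add: M.refines_transpose)
    qed
  qed
qed

section \<open>Induction on the support\<close>

lemma split_max_opt:
  assumes B: "B \<in> carrier (MJ J)" and m: "m \<in> Idx J" "\<forall>x\<in>fst B. \<not> lt J m x"
  obtains B0 Bm g where "B0 \<in> carrier (MJ J)" "Bm \<in> carrier (MJ J)" "opt_principal m Bm g" "fst B0 = fst B - {m}"
    "B = B0 \<otimes>\<^bsub>MJ J\<^esub> Bm"
proof (cases "m \<in> fst B")
  case True
  then have "m \<in> Mx J (fst B)" using m by (simp add: Mx_def)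
  then obtain B0 g where "B0 \<in> carrier (MJ J)" "g \<in> carrier (semi J m)" "fst B0 = fst B - {m}"
    "B = B0 \<otimes>\<^bsub>MJ J\<^esub> principal m g" by (rule split_max[OF B])
  then show ?thesis using that[of B0 "principal m g" g] principal_closed m by (simp add: opt_principal_def)
next
  case False
  then show ?thesis using that[of B "\<one>\<^bsub>MJ J\<^esub>" "\<one>\<^bsub>hatG J m\<^esub>"] B by (simp add: opt_principal_def)
qed

lemma principal_mult_opt:
  assumes "m \<in> Idx J" "g \<in> carrier (semi J m)" "opt_principal m B h"
  shows "h \<in> carrier (hatG J m)" "g \<otimes>\<^bsub>hatG J m\<^esub> h \<in> carrier (semi J m)"
    "principal m g \<otimes>\<^bsub>MJ J\<^esub> B = principal m (g \<otimes>\<^bsub>hatG J m\<^esub> h)"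
  using assms principal_closed[OF assms(1,2)] semi_hatG[OF assms(2)] semi_hatG[of h m]
  by (auto simp del: split_paired_All 
      simp: opt_principal_def principal_mult semi_mult_semi hatG_r_one hatG_one_closed)

text \<open>The corrections \<open>Z\<close> and \<open>Z'\<close> are added to the parts of
  \<open>A\<close> and \<open>C\<close> off \<open>m\<close> and compensated in their components at
  \<open>m\<close>. This is why \<open>m\<close> is assumed to lie in the supports of both;
  \<open>B\<close> and \<open>D\<close> may lack a component there.\<close>

lemma refinement_step:
  assumes A: "A \<in> carrier (MJ J)" and B: "B \<in> carrier (MJ J)" and C: "C \<in> carrier (MJ J)" and D: "D \<in> carrier (MJ J)" 
    and eq: "A \<otimes>\<^bsub>MJ J\<^esub> B = C \<otimes>\<^bsub>MJ J\<^esub> D"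
    and m: "m \<in> Mx J (fst A \<union> fst B)" "m \<in> fst A" "m \<in> fst C"
    and IH: "\<And>A' B' C' D'. A' \<in> carrier (MJ J) \<Longrightarrow> B' \<in> carrier (MJ J) \<Longrightarrow> C' \<in> carrier (MJ J) \<Longrightarrow> 
      D' \<in> carrier (MJ J) \<Longrightarrow> A' \<otimes>\<^bsub>MJ J\<^esub> B' = C' \<otimes>\<^bsub>MJ J\<^esub> D' \<Longrightarrow> fst A' \<union> fst B' = fst A \<union> fst B - {m} \<Longrightarrow>
      refines (MJ J) A' B' C' D'"
  shows "refines (MJ J) A B C D"
proof -
  have ABCD: "fst A \<union> fst B = fst C \<union> fst D" using eq fst_mult A B C D by metis
  have max: "\<forall>x\<in>fst A \<union> fst B. \<not> lt J m x" using m by (simp add: Mx_def)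
  then have max': "m \<in> Mx J (fst A)" "m \<in> Mx J (fst C)" "\<forall>x\<in>fst B. \<not> lt J m x" "\<forall>x\<in>fst D. \<not> lt J m x"
    using ABCD m by (auto simp: Mx_def)
  have mI: "m \<in> Idx J" using AI_subset[OF fst_MJ[OF A]] m by blast
  interpret G: comm_group "hatG J m" using hatG_group mI by simp
  obtain A0 gA where A0: "A0 \<in> carrier (MJ J)" "gA \<in> carrier (semi J m)" "fst A0 = fst A - {m}"
    "A = A0 \<otimes>\<^bsub>MJ J\<^esub> principal m gA" by (rule split_max[OF A max'(1)])
  obtain C0 gC where C0: "C0 \<in> carrier (MJ J)" "gC \<in> carrier (semi J m)" "fst C0 = fst C - {m}"
    "C = C0 \<otimes>\<^bsub>MJ J\<^esub> principal m gC" by (rule split_max[OF C max'(2)])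
  obtain B0 Bm gB where B0: "B0 \<in> carrier (MJ J)" "Bm \<in> carrier (MJ J)" "opt_principal m Bm gB" "fst B0 = fst B - {m}"
    "B = B0 \<otimes>\<^bsub>MJ J\<^esub> Bm" by (rule split_max_opt[OF B mI max'(3)])
  obtain D0 Dm gD where D0: "D0 \<in> carrier (MJ J)" "Dm \<in> carrier (MJ J)" "opt_principal m Dm gD" "fst D0 = fst D - {m}"
    "D = D0 \<otimes>\<^bsub>MJ J\<^esub> Dm" by (rule split_max_opt[OF D mI max'(4)])
  note eA = principal_closed[OF mI A0(2)] and eC = principal_closed[OF mI C0(2)]
  note oB = principal_mult_opt[OF mI A0(2) B0(3)] and oD = principal_mult_opt[OF mI C0(2) D0(3)]
  have "A \<otimes>\<^bsub>MJ J\<^esub> B = (A0 \<otimes>\<^bsub>MJ J\<^esub> B0) \<otimes>\<^bsub>MJ J\<^esub> (principal m gA \<otimes>\<^bsub>MJ J\<^esub> Bm)"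
    using A0(1,4) B0(1,2,5) eA by (simp add: M.m_ac)
  moreover have "C \<otimes>\<^bsub>MJ J\<^esub> D = (C0 \<otimes>\<^bsub>MJ J\<^esub> D0) \<otimes>\<^bsub>MJ J\<^esub> (principal m gC \<otimes>\<^bsub>MJ J\<^esub> Dm)"
    using C0(1,4) D0(1,2,5) eC by (simp add: M.m_ac)
  ultimately have eq': "(A0 \<otimes>\<^bsub>MJ J\<^esub> B0) \<otimes>\<^bsub>MJ J\<^esub> principal m (gA \<otimes>\<^bsub>hatG J m\<^esub> gB) = (C0 \<otimes>\<^bsub>MJ J\<^esub> D0) \<otimes>\<^bsub>MJ J\<^esub> principal m (gC \<otimes>\<^bsub>hatG J m\<^esub> gD)"
    using eq oB(3) oD(3) by simp
  have AB0: "A0 \<otimes>\<^bsub>MJ J\<^esub> B0 \<in> carrier (MJ J)" "C0 \<otimes>\<^bsub>MJ J\<^esub> D0 \<in> carrier (MJ J)" 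
    "m \<notin> fst (A0 \<otimes>\<^bsub>MJ J\<^esub> B0)" "m \<notin> fst (C0 \<otimes>\<^bsub>MJ J\<^esub> D0)"
    using A0 B0 C0 D0 by (auto simp: fst_mult)
  obtain Z Z' h h' where Z: "Z \<in> carrier (MJ J)" "Z' \<in> carrier (MJ J)" "fst Z = sdown m" "fst Z' = sdown m"
    and h: "h \<in> G0 m" "h' \<in> G0 m" 
    and ZZ: "(A0 \<otimes>\<^bsub>MJ J\<^esub> B0) \<otimes>\<^bsub>MJ J\<^esub> Z = (C0 \<otimes>\<^bsub>MJ J\<^esub> D0) \<otimes>\<^bsub>MJ J\<^esub> Z'" 
    and hh: "(gA \<otimes>\<^bsub>hatG J m\<^esub> gB) \<otimes>\<^bsub>hatG J m\<^esub> h' = (gC \<otimes>\<^bsub>hatG J m\<^esub> gD) \<otimes>\<^bsub>hatG J m\<^esub> h"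
    and absorb: "\<And>k. k \<in> carrier (semi J m) \<Longrightarrow> principal m k \<otimes>\<^bsub>MJ J\<^esub> Z = principal m (k \<otimes>\<^bsub>hatG J m\<^esub> h)"
    "\<And>k. k \<in> carrier (semi J m) \<Longrightarrow> principal m k \<otimes>\<^bsub>MJ J\<^esub> Z' = principal m (k \<otimes>\<^bsub>hatG J m\<^esub> h')"
    by (rule cancel_max[OF AB0(1,2) mI AB0(3,4) oB(2) oD(2) eq']) blast
  \<comment> \<open>The support of \<open>Z\<close> is already contained in that of
    \<open>A0\<close>, so adding \<open>Z\<close> keeps the total support at \<open>e - {m}\<close>,
    with \<open>e\<close> the common support, and the induction hypothesis applies.\<close>
  have sd: "sdown m \<subseteq> fst A - {m}" using sdown_subset[OF fst_MJ[OF A] m(2)] sdown_irrefl by blast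
  have R1: "refines (MJ J) (A0 \<otimes>\<^bsub>MJ J\<^esub> Z) B0 (C0 \<otimes>\<^bsub>MJ J\<^esub> Z') D0"
  proof (rule IH)
    show "(A0 \<otimes>\<^bsub>MJ J\<^esub> Z) \<otimes>\<^bsub>MJ J\<^esub> B0 = (C0 \<otimes>\<^bsub>MJ J\<^esub> Z') \<otimes>\<^bsub>MJ J\<^esub> D0"
      using ZZ A0(1) B0(1) C0(1) D0(1) Z by (simp add: M.m_ac)
    show "fst (A0 \<otimes>\<^bsub>MJ J\<^esub> Z) \<union> fst B0 = fst A \<union> fst B - {m}"
      using A0 B0 Z sd by (auto simp: fst_mult)
  qed (use A0 B0 C0 D0 Z in auto)
  have hc: "h \<in> carrier (hatG J m)" "h' \<in> carrier (hatG J m)" using h by (auto simp: G0_iff)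
  have gc: "gA \<in> carrier (hatG J m)" "gC \<in> carrier (hatG J m)" using A0 C0 semi_hatG by auto
  \<comment> \<open>These are chosen so that absorbing \<open>Z\<close> and \<open>Z'\<close> brings
    back \<open>gA\<close> and \<open>gC\<close>; degrees are unchanged, so they stay in the
    semigroup.\<close>
  define kA where "kA = gA \<otimes>\<^bsub>hatG J m\<^esub> inv\<^bsub>hatG J m\<^esub> h"
  define kC where "kC = gC \<otimes>\<^bsub>hatG J m\<^esub> inv\<^bsub>hatG J m\<^esub> h'"
  have k: "kA \<in> carrier (semi J m)" "kC \<in> carrier (semi J m)"
    unfolding kA_def kC_def using semi_mult_G0[OF mI _ G0_inv[OF mI]] A0 C0 h by auto
  note kc = k[THEN semi_hatG]
  have kg: "kA \<otimes>\<^bsub>hatG J m\<^esub> h = gA" "kC \<otimes>\<^bsub>hatG J m\<^esub> h' = gC"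
    using gc hc by (simp_all add: kA_def kC_def G.m_assoc)
  \<comment> \<open>Adding \<open>h\<close> and \<open>h'\<close> to both sides reduces the equation
    to \<open>hh\<close>; they are then cancelled in the group.\<close>
  have "(kA \<otimes>\<^bsub>hatG J m\<^esub> gB) \<otimes>\<^bsub>hatG J m\<^esub> (h \<otimes>\<^bsub>hatG J m\<^esub> h') = (gA \<otimes>\<^bsub>hatG J m\<^esub> gB) \<otimes>\<^bsub>hatG J m\<^esub> h'"
    unfolding kg(1)[symmetric] using kc hc oB(1) by (simp add: G.m_ac)
  also have "\<dots> = (kC \<otimes>\<^bsub>hatG J m\<^esub> gD) \<otimes>\<^bsub>hatG J m\<^esub> (h \<otimes>\<^bsub>hatG J m\<^esub> h')"
    unfolding hh unfolding kg(2)[symmetric] using kc hc oD(1) by (simp add: G.m_ac)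
  finally have "kA \<otimes>\<^bsub>hatG J m\<^esub> gB = kC \<otimes>\<^bsub>hatG J m\<^esub> gD" using kc hc oB(1) oD(1) by simp
  from local_refinement[OF mI k B0(3) D0(3) this]
  have R2: "refines (MJ J) (principal m kA) Bm (principal m kC) Dm" .
  have "(A0 \<otimes>\<^bsub>MJ J\<^esub> Z) \<otimes>\<^bsub>MJ J\<^esub> principal m kA = A0 \<otimes>\<^bsub>MJ J\<^esub> (principal m kA \<otimes>\<^bsub>MJ J\<^esub> Z)"
    using A0(1) Z principal_closed[OF mI k(1)] by (simp add: M.m_ac)
  then have "(A0 \<otimes>\<^bsub>MJ J\<^esub> Z) \<otimes>\<^bsub>MJ J\<^esub> principal m kA = A" using absorb(1)[OF k(1)] kg A0(4) by simp
  moreover have "(C0 \<otimes>\<^bsub>MJ J\<^esub> Z') \<otimes>\<^bsub>MJ J\<^esub> principal m kC = C0 \<otimes>\<^bsub>MJ J\<^esub> (principal m kC \<otimes>\<^bsub>MJ J\<^esub> Z')"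
    using C0(1) Z principal_closed[OF mI k(2)] by (simp add: M.m_ac)
  then have "(C0 \<otimes>\<^bsub>MJ J\<^esub> Z') \<otimes>\<^bsub>MJ J\<^esub> principal m kC = C" using absorb(2)[OF k(2)] kg C0(4) by simp
  ultimately show ?thesis using M.refines_mult[OF R1 R2] B0(5) D0(5) by simp
qed

text \<open>Induction on the size of the common support; with empty support all four elements are
  neutral.\<close>

lemma refinement:
  assumes "A \<in> carrier (MJ J)" "B \<in> carrier (MJ J)" "C \<in> carrier (MJ J)" "D \<in> carrier (MJ J)" 
    "A \<otimes>\<^bsub>MJ J\<^esub> B = C \<otimes>\<^bsub>MJ J\<^esub> D"
  shows "refines (MJ J) A B C D"
  using assms
proof (induction "card (fst A \<union> fst B)" arbitrary: A B C D rule: less_induct)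
  case less
  have ABCD: "fst A \<union> fst B = fst C \<union> fst D" using less.prems fst_mult by metis
  have sub: "fst A \<union> fst B \<subseteq> Idx J" using less.prems AI_subset fst_MJ by (meson Un_least)
  show ?case
  proof (cases "fst A \<union> fst B = {}")
    case True
    have "E = \<one>\<^bsub>MJ J\<^esub>" if "E \<in> carrier (MJ J)" "fst E = {}" for E
      by (rule MJ_obtain[OF that(1)]) (use that(2) HT_empty cls_one in auto)
    moreover have "fst A = {}" "fst B = {}" "fst C = {}" "fst D = {}" using True ABCD by auto
    ultimately have "A = \<one>\<^bsub>MJ J\<^esub>" "B = \<one>\<^bsub>MJ J\<^esub>" "C = \<one>\<^bsub>MJ J\<^esub>" "D = \<one>\<^bsub>MJ J\<^esub>" 
      using less.prems by blast+
    then show ?thesis by (intro refinesI[of "\<one>\<^bsub>MJ J\<^esub>" _ "\<one>\<^bsub>MJ J\<^esub>" "\<one>\<^bsub>MJ J\<^esub>" "\<one>\<^bsub>MJ J\<^esub>"]) auto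
  next
    case False
    then obtain m where m: "m \<in> Mx J (fst A \<union> fst B)" using exists_maximal[OF sub] by blast
    have step: "refines (MJ J) A' B' C' D'" 
      if "A' \<in> carrier (MJ J)" "B' \<in> carrier (MJ J)" "C' \<in> carrier (MJ J)" "D' \<in> carrier (MJ J)" 
        "A' \<otimes>\<^bsub>MJ J\<^esub> B' = C' \<otimes>\<^bsub>MJ J\<^esub> D'" "fst A' \<union> fst B' = fst A \<union> fst B" "m \<in> fst A'" "m \<in> fst C'" for A' B' C' D'
    proof (rule refinement_step[OF that(1-5) _ that(7,8)])
      show "m \<in> Mx J (fst A' \<union> fst B')" using that(6) m by simp
      fix A1 B1 C1 D1 assume 1: "A1 \<in> carrier (MJ J)" "B1 \<in> carrier (MJ J)" "C1 \<in> carrier (MJ J)" "D1 \<in> carrier (MJ J)" 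
        "A1 \<otimes>\<^bsub>MJ J\<^esub> B1 = C1 \<otimes>\<^bsub>MJ J\<^esub> D1" "fst A1 \<union> fst B1 = fst A' \<union> fst B' - {m}"
      have "finite (fst A \<union> fst B)" using sub fin finite_subset by blast
      moreover have "m \<in> fst A \<union> fst B" using m by (simp add: Mx_def)
      ultimately have "card (fst A1 \<union> fst B1) < card (fst A \<union> fst B)"
        unfolding 1(6) that(6) by (rule card_Diff1_less)
      from less.hyps[OF this 1(1-5)] show "refines (MJ J) A1 B1 C1 D1" .
    qed
    have comm: "A \<otimes>\<^bsub>MJ J\<^esub> B = B \<otimes>\<^bsub>MJ J\<^esub> A" "C \<otimes>\<^bsub>MJ J\<^esub> D = D \<otimes>\<^bsub>MJ J\<^esub> C" using less.prems M.m_comm by auto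
    \<comment> \<open>A maximal \<open>m\<close> lies in the support of \<open>A\<close> or
      \<open>B\<close> and in that of \<open>C\<close> or \<open>D\<close>. Exchanging the terms on
      either side reduces the four cases to \<open>A\<close> and \<open>C\<close>.\<close>
    have "m \<in> fst A \<union> fst B" "m \<in> fst C \<union> fst D" using m ABCD by (auto simp: Mx_def)
    then consider "m \<in> fst A" "m \<in> fst C" | "m \<in> fst A" "m \<in> fst D" | "m \<in> fst B" "m \<in> fst C" | "m \<in> fst B" "m \<in> fst D"
      by blast
    then show ?thesis
    proof cases
      case 1
      then show ?thesis using step[of A B C D] less.prems by simp
    next
      case 2
      then have "refines (MJ J) A B D C" using step[of A B D C] less.prems comm by simp
      then show ?thesis by (rule M.refines_swap')
    next
      case 3
      then have "refines (MJ J) B A C D" using step[of B A C D] less.prems comm by (simp add: Un_commute)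
      then show ?thesis by (rule M.refines_swap)
    next
      case 4
      then have "refines (MJ J) B A D C" using step[of B A D C] less.prems comm by (simp add: Un_commute)
      then show ?thesis by (rule M.refines_swap[OF M.refines_swap'])
    qed
  qed
qed

end

theorem theorem3p15:
  fixes J :: "('i, 'g) sys"
  assumes "I_system J" and "finite (Idx J)"
  shows "conical_monoid (MJ J) \<and> refinement_monoid (MJ J)"
proof -
  interpret isystem J using assms by unfold_locales
  have "refinement_monoid (MJ J)"
    using refinement M.comm_monoid_axioms unfolding refinement_monoid_def refines_def by blast
  then show ?thesis using conical by simp
qed

end
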